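(* Let $\ell>0$ and let $q=\sum_{k\ge0}c_k\delta_{\ell k}$, $c_k\in\mathbb{C}$, be a discrete complex-valued measure on $\mathbb{R}_+$ with $\operatorname{supp} q\subset\ell\mathbb{Z}_+$. Then the Schur function $f_q$ of $\mathcal D_q$ belongs to $S_{\ell,*}(\mathbb{C}_+)$ (in particular, it is $\pi/\ell$-periodic). Any element of $S_{\ell,*}(\mathbb{C}_+)$ arises uniquely in this way, i.e., as $f_q$ for a unique such $q$. Moreover, $q$ and $f_q$ determine each other via $$q(\{\ell k\})=\varkappa(f_{q,k}(\infty)),\qquad k\in\mathbb{Z}_+,$$ where $\{f_{q,k}(\infty)\}_{k\in\mathbb{Z}_+}$ is the sequence of recurrence coefficients of $f_q$.
   Context: $\mathbb{R}_+=[0,\infty)$, $\mathbb{Z}_+=\{0,1,2,\dots\}$, $\mathbb{C}_+=\{\operatorname{Im}z>0\}$, $\mathbb{D}=\{|z|<1\}$, $\delta_a$ is the unit point mass at $a$; the $c_k$ are arbitrary (no summability is assumed). Schur function of a Dirac operator with a measure potential. Let $\mathcal M$ be the set of complex Borel measures $q$ on $\mathbb{R}$ supported in $\mathbb{R}_+$ with finite total variation on each $[0,L]$. Put $J=\begin{pmatrix}0&-1\\ 1&0\end{pmatrix}$, $Q=\begin{pmatrix}\operatorname{Im}q&\operatorname{Re}q\\ \operatorname{Re}q&-\operatorname{Im}q\end{pmatrix}$ (a matrix-valued measure), and $\mathbf g(T)=I+\sum_{n\ge2}T^{n-1}/n!$ for $2\times2$ matrices $T$ ($I$ the identity matrix).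 For $z\in\mathbb{C}$ the Dirac system $JN'+QN=zN$ with $N=I$ on $(-\infty,0)$ is understood in the sense of Persson: $N(\cdot,z)=\begin{pmatrix}n_{11}&n_{12}\\ n_{21}&n_{22}\end{pmatrix}$ is the unique right-continuous (in $x$) matrix function, of locally bounded variation, with $$JN(x,z)+\int_{(-\infty,x]}\mathbf g\bigl(Q(\{x_1\})J^*\bigr)\bigl(dQ(x_1)-z\,\chi_{\mathbb{R}_+}(x_1)\,dx_1\bigr)N(x_1,z)=J,\qquad x\in\mathbb{R}.$$ The Weyl function of $\mathcal D_q$ is $m_q(z)=\lim_{x\to+\infty}n_{22}(x,z)/n_{21}(x,z)$, $z\in\mathbb{C}_+$, and the Schur function $f_q$ is defined by $m_q=i\frac{1+f_q}{1-f_q}$; it is analytic with $|f_q|\le 1$ on $\mathbb{C}_+$. Periodic Schur class. $S_*(\mathbb{D})$ is the set of analytic $F$ on $\mathbb{D}$ with $|F|\le1$ that are not finite Blaschke products (unimodular constants count as finite Blaschke products). $S_{\ell,*}(\mathbb{C}_+)=\{f:\mathbb{C}_+\to\mathbb{D}:\ f(z)=F(e^{2i\ell z}),\ F\in S_*(\mathbb{D})\}$. For $f\in S_{\ell,*}(\mathbb{C}_+)$ define $f_0=f$ and $$e^{2i\ell z}f_{k+1}=\frac{f_k-f_k(\infty)}{1-\overline{f_k(\infty)}f_k},\qquad f_k(\infty)=\lim_{y\to+\infty}f_k(iy),\qquad k\ge0;$$ the numbers $f_k(\infty)\in\mathbb{D}$ are the recurrence coefficients of $f$; for $f=f_q$ the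 iterates are denoted $f_{q,k}$. The bijection $\varkappa:\mathbb{D}\to\mathbb{C}$ is $\varkappa(w)=\frac{\overline w}{2|w|}\log\frac{1+|w|}{1-|w|}$ for $w\neq 0$, $\varkappa(0)=0$. *)

theory Defs
  imports "HOL-Complex_Analysis.Complex_Analysis"
begin


abbreviation bounded_borel :: "real set set" where
  "bounded_borel \<equiv> {A \<in> sets borel. bounded A}"

text \<open>
  A complex measure that has finite total variation only on bounded sets has no value on
  unbounded sets. We represent it by its values on the bounded Borel sets, extended by 0 to all
  other sets, so that two measures are equal iff the functions are equal.
\<close>

definition complex_measures_Rplus :: "(real set \<Rightarrow> complex) set" where
  "complex_measures_Rplus = {q.
     (\<forall>A :: nat \<Rightarrow> real set. range A \<subseteq> bounded_borel \<and> disjoint_family A \<and> bounded (\<Union>n. A n)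
        \<longrightarrow> (\<lambda>n. q (A n)) sums q (\<Union>n. A n)) \<and>
     (\<forall>L. \<exists>B. \<forall>P. finite P \<and> disjoint P \<and> P \<subseteq> sets borel \<and> \<Union>P \<subseteq> {0..L}
        \<longrightarrow> (\<Sum>A\<in>P. norm (q A)) \<le> B) \<and>
     (\<forall>A\<in>bounded_borel. A \<inter> {0..} = {} \<longrightarrow> q A = 0) \<and>
     (\<forall>A. A \<notin> bounded_borel \<longrightarrow> q A = 0)}"

text \<open>
  Integration with respect to a complex measure goes through the Jordan decompositions of its
  real and imaginary parts; \<open>pos_variation m\<close> is the positive variation of the real measure
  \<open>m\<close>, and \<open>pos_variation (- m)\<close> is its negative variation. (\<open>ennreal\<close> sends negative numbers
  to 0, which is harmless since \<open>m {} = 0\<close>.)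
\<close>

definition pos_variation :: "(real set \<Rightarrow> real) \<Rightarrow> real measure" where
  "pos_variation m = measure_of UNIV (sets borel)
     (\<lambda>A. SUP B\<in>{B \<in> bounded_borel. B \<subseteq> A}. ennreal (m B))"

definition signed_integral :: "(real set \<Rightarrow> real) \<Rightarrow> real set \<Rightarrow> (real \<Rightarrow> complex) \<Rightarrow> complex" where
  "signed_integral m S f =
     (LINT t:S|pos_variation m. f t) - (LINT t:S|pos_variation (\<lambda>A. - m A). f t)"

definition complex_integral :: "(real set \<Rightarrow> complex) \<Rightarrow> real set \<Rightarrow> (real \<Rightarrow> complex) \<Rightarrow> complex" where
  "complex_integral q S f =
     signed_integral (\<lambda>A. Re (q A)) S f + \<i> * signed_integral (\<lambda>A. Im (q A)) S f"

definition point_mass_sum :: "real \<Rightarrow> (nat \<Rightarrow> complex) \<Rightarrow> real set \<Rightarrow> complex" where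
  "point_mass_sum ell c A = (if A \<in> bounded_borel then \<Sum>k | ell * real k \<in> A. c k else 0)"

definition discrete_measures :: "real \<Rightarrow> (real set \<Rightarrow> complex) set" where
  "discrete_measures ell = {q \<in> complex_measures_Rplus. \<exists>c. q = point_mass_sum ell c}"



definition J :: "complex^2^2" where
  "J = vector [vector [0, -1], vector [1, 0]]"

definition potential :: "(real set \<Rightarrow> complex) \<Rightarrow> real set \<Rightarrow> complex^2^2" where
  "potential q A = vector [vector [of_real (Im (q A)), of_real (Re (q A))],
                           vector [of_real (Re (q A)), - of_real (Im (q A))]]"

text \<open>
  Powers of \<open>T\<close> are written as iterated matrix multiplication, because the operations
  \<open>*\<close> and \<open>^\<close> on vectors are componentwise.
\<close>

definition gmat :: "complex^2^2 \<Rightarrow> complex^2^2" where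
  "gmat T = mat 1 + (\<Sum>n. (1 / fact (n + 2)) *\<^sub>R (((**) T) ^^ (n + 1)) (mat 1))"

text \<open>
  The integral of \<open>g(Q({t}) J\<^sup>*) (dQ(t) - z \<chi> dt) N(t)\<close> over \<open>S\<close>. Here \<open>J\<^sup>*\<close> is the
  transpose, as \<open>J\<close> is real.
\<close>

definition persson_integral ::
  "(real set \<Rightarrow> complex) \<Rightarrow> complex \<Rightarrow> real set \<Rightarrow> (real \<Rightarrow> complex^2^2) \<Rightarrow> complex^2^2" where
  "persson_integral q z S N =
     (let G = (\<lambda>t. gmat (potential q {t} ** transpose J)) in
      \<chi> i l. (\<Sum>j\<in>UNIV. \<Sum>k\<in>UNIV.
                 complex_integral (\<lambda>A. potential q A $ j $ k) S (\<lambda>t. G t $ i $ j * N t $ k $ l))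
              - z * (LINT t:S|lborel. of_real (indicat_real {0..} t) * (G t ** N t) $ i $ l))"

definition locally_bounded_variation :: "(real \<Rightarrow> 'a::real_normed_vector) \<Rightarrow> bool" where
  "locally_bounded_variation f \<longleftrightarrow>
     (\<forall>a b. \<exists>B. \<forall>n (t :: nat \<Rightarrow> real). mono t \<and> range t \<subseteq> {a..b}
        \<longrightarrow> (\<Sum>i<n. norm (f (t (Suc i)) - f (t i))) \<le> B)"

definition is_dirac_solution ::
  "(real set \<Rightarrow> complex) \<Rightarrow> complex \<Rightarrow> (real \<Rightarrow> complex^2^2) \<Rightarrow> bool" where
  "is_dirac_solution q z N \<longleftrightarrow>
     (\<forall>x. continuous (at_right x) N) \<and> locally_bounded_variation N \<and>
     (\<forall>x. J ** N x + persson_integral q z {..x} N = J)"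

definition dirac_solution :: "(real set \<Rightarrow> complex) \<Rightarrow> complex \<Rightarrow> real \<Rightarrow> complex^2^2" where
  "dirac_solution q z = (THE N. is_dirac_solution q z N)"

abbreviation upper_half_plane :: "complex set"  (\<open>\<complex>\<^sub>+\<close>) where
  "\<complex>\<^sub>+ \<equiv> {z. Im z > 0}"

definition weyl_function :: "(real set \<Rightarrow> complex) \<Rightarrow> complex \<Rightarrow> complex" where
  "weyl_function q z =
     Lim at_top (\<lambda>x. dirac_solution q z x $ 2 $ 2 / dirac_solution q z x $ 2 $ 1)"

text \<open>The condition \<open>w \<noteq> 1\<close> is needed only because division by zero yields 0.\<close>

definition schur_function :: "(real set \<Rightarrow> complex) \<Rightarrow> complex \<Rightarrow> complex" where
  "schur_function q z = (THE w. w \<noteq> 1 \<and> weyl_function q z = \<i> * ((1 + w) / (1 - w)))"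



text \<open>
  The list contains the zeros with their multiplicities; the empty list gives the unimodular
  constants.
\<close>

definition finite_Blaschke_product :: "(complex \<Rightarrow> complex) \<Rightarrow> bool" where
  "finite_Blaschke_product F \<longleftrightarrow>
     (\<exists>u as. norm u = 1 \<and> set as \<subseteq> ball 0 1 \<and>
        (\<forall>z\<in>ball 0 1. F z = u * (\<Prod>a\<leftarrow>as. (z - a) / (1 - cnj a * z))))"

definition schur_star_disk :: "(complex \<Rightarrow> complex) set" where
  "schur_star_disk = {F. F holomorphic_on ball 0 1 \<and> (\<forall>z\<in>ball 0 1. norm (F z) \<le> 1) \<and>
                         \<not> finite_Blaschke_product F}"

definition schur_star_periodic :: "real \<Rightarrow> (complex \<Rightarrow> complex) set" where
  "schur_star_periodic ell = {f. (\<forall>z\<in>\<complex>\<^sub>+. f z \<in> ball 0 1) \<and>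
     (\<exists>F\<in>schur_star_disk. \<forall>z\<in>\<complex>\<^sub>+. f z = F (exp (2 * \<i> * of_real ell * z)))}"

definition value_at_i_infinity :: "(complex \<Rightarrow> complex) \<Rightarrow> complex" where
  "value_at_i_infinity f = Lim at_top (\<lambda>y :: real. f (\<i> * of_real y))"

primrec schur_iterate :: "real \<Rightarrow> (complex \<Rightarrow> complex) \<Rightarrow> nat \<Rightarrow> complex \<Rightarrow> complex" where
  "schur_iterate ell f 0 = f"
| "schur_iterate ell f (Suc k) = (\<lambda>z.
     let g = schur_iterate ell f k; a = value_at_i_infinity g in
     (g z - a) / (1 - cnj a * g z) / exp (2 * \<i> * of_real ell * z))"

definition recurrence_coeff :: "real \<Rightarrow> (complex \<Rightarrow> complex) \<Rightarrow> nat \<Rightarrow> complex" where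
  "recurrence_coeff ell f k = value_at_i_infinity (schur_iterate ell f k)"

definition varkappa :: "complex \<Rightarrow> complex" where
  "varkappa w = (if w = 0 then 0
     else cnj w / of_real (2 * norm w) * of_real (ln ((1 + norm w) / (1 - norm w))))"



lemma finite_lattice_points:
  assumes "ell > 0" "bounded A"
  shows "finite {k. ell * real k \<in> A}"
proof -
  obtain B where B: "\<And>x. x \<in> A \<Longrightarrow> \<bar>x\<bar> \<le> B"
    using assms(2) by (auto simp: bounded_iff)
  have "k \<le> nat \<lceil>B / ell\<rceil>" if "ell * real k \<in> A" for k
  proof -
    have "ell * real k \<le> B" using B[OF that] by simp
    hence "real k \<le> B / ell" using assms(1) by (simp add: field_simps)
    thus ?thesis by linarith
  qed
  hence "{k. ell * real k \<in> A} \<subseteq> {..nat \<lceil>B / ell\<rceil>}" by auto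
  thus ?thesis by (rule finite_subset) simp
qed

lemma point_mass_sum_indicator:
  assumes "finite K" "{k. ell * real k \<in> A} \<subseteq> K" "A \<in> bounded_borel"
  shows "point_mass_sum ell c A = (\<Sum>k\<in>K. if ell * real k \<in> A then c k else 0)"
proof -
  have "(\<Sum>k\<in>K. if ell * real k \<in> A then c k else 0) = (\<Sum>k\<in>{k\<in>K. ell * real k \<in> A}. c k)"
    using assms(1) by (simp add: sum.inter_filter)
  also have "{k\<in>K. ell * real k \<in> A} = {k. ell * real k \<in> A}" using assms(2) by auto
  finally show ?thesis using assms(3) by (simp add: point_mass_sum_def)
qed

lemma point_mass_sum_singleton:
  assumes "ell > 0"
  shows "point_mass_sum ell c {ell * real k} = c k"
proof -
  have "{j. ell * real j \<in> {ell * real k}} = {k}" using assms by auto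
  thus ?thesis by (simp add: point_mass_sum_def)
qed

lemma point_mass_sum_in_measures:
  assumes l: "ell > 0"
  shows "point_mass_sum ell c \<in> complex_measures_Rplus"
proof -
  let ?q = "point_mass_sum ell c"
  have sums: "(\<lambda>n. ?q (A n)) sums ?q (\<Union>n. A n)"
    if A: "range A \<subseteq> bounded_borel" "disjoint_family A" "bounded (\<Union>n. A n)"
    for A :: "nat \<Rightarrow> real set"
  proof -
    define K where "K = {k. ell * real k \<in> (\<Union>n. A n)}"
    have K: "finite K" unfolding K_def by (rule finite_lattice_points[OF l A(3)])
    have U: "(\<Union>n. A n) \<in> bounded_borel" using A by auto
    have eqn: "?q (A n) = (\<Sum>k\<in>K. if ell * real k \<in> A n then c k else 0)" for n
      by (rule point_mass_sum_indicator) (use A K in \<open>auto simp: K_def\<close>)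
    have eqU: "?q (\<Union>n. A n) = (\<Sum>k\<in>K. c k)"
      using U by (simp add: point_mass_sum_def K_def)
    have "(\<lambda>n. if ell * real k \<in> A n then c k else 0) sums c k" if kK: "k \<in> K" for k
    proof -
      obtain m where m: "ell * real k \<in> A m" using kK by (auto simp: K_def)
      have "ell * real k \<in> A n \<longleftrightarrow> n = m" for n
        using m A(2) by (auto simp: disjoint_family_on_def)
      thus ?thesis using sums_single[of m "\<lambda>_. c k"] by simp
    qed
    thus ?thesis unfolding eqn eqU by (rule sums_sum)
  qed
  have var: "\<exists>B. \<forall>P. finite P \<and> disjoint P \<and> P \<subseteq> sets borel \<and> \<Union>P \<subseteq> {0..L}
        \<longrightarrow> (\<Sum>A\<in>P. norm (?q A)) \<le> B" for L :: real
  proof -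
    define K where "K = {k. ell * real k \<in> {0..L}}"
    have K: "finite K" unfolding K_def by (rule finite_lattice_points[OF l]) simp
    have "(\<Sum>A\<in>P. norm (?q A)) \<le> (\<Sum>k\<in>K. norm (c k))"
      if P: "finite P" "disjoint P" "P \<subseteq> sets borel" "\<Union>P \<subseteq> {0..L}" for P
    proof -
      have bb: "A \<in> bounded_borel" if "A \<in> P" for A
        using that P bounded_subset[of "{0..L}" A] by auto
      have "norm (?q A) \<le> (\<Sum>k\<in>K. if ell * real k \<in> A then norm (c k) else 0)" if "A \<in> P" for A
      proof -
        have "?q A = (\<Sum>k\<in>K. if ell * real k \<in> A then c k else 0)"
          by (rule point_mass_sum_indicator) (use K P that bb in \<open>auto simp: K_def\<close>)
        also have "norm \<dots> \<le> (\<Sum>k\<in>K. norm (if ell * real k \<in> A then c k else 0))"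
          by (rule norm_sum)
        also have "\<dots> = (\<Sum>k\<in>K. if ell * real k \<in> A then norm (c k) else 0)"
          by (rule sum.cong) auto
        finally show ?thesis .
      qed
      hence "(\<Sum>A\<in>P. norm (?q A))
          \<le> (\<Sum>A\<in>P. \<Sum>k\<in>K. if ell * real k \<in> A then norm (c k) else 0)"
        by (rule sum_mono)
      also have "\<dots> = (\<Sum>k\<in>K. \<Sum>A\<in>P. if ell * real k \<in> A then norm (c k) else 0)"
        by (rule sum.swap)
      also have "\<dots> \<le> (\<Sum>k\<in>K. norm (c k))"
      proof (rule sum_mono)
        fix k
        have "(\<Sum>A\<in>P. if ell * real k \<in> A then norm (c k) else 0)
            = (\<Sum>A\<in>{A\<in>P. ell * real k \<in> A}. norm (c k))"
          using P(1) by (simp only: sum.inter_filter)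
        also have "\<dots> = real (card {A\<in>P. ell * real k \<in> A}) * norm (c k)" by simp
        also have "card {A\<in>P. ell * real k \<in> A} \<le> 1"
          using P(1,2) by (subst One_nat_def, subst card_le_Suc0_iff_eq)
            (auto simp: disjoint_def)
        hence "real (card {A\<in>P. ell * real k \<in> A}) * norm (c k) \<le> 1 * norm (c k)"
          by (intro mult_right_mono) auto
        finally show "(\<Sum>A\<in>P. if ell * real k \<in> A then norm (c k) else 0) \<le> norm (c k)" by simp
      qed
      finally show ?thesis .
    qed
    thus ?thesis by blast
  qed
  have supp: "?q A = 0" if "A \<inter> {0..} = {}" for A
  proof -
    have "{k. ell * real k \<in> A} = {}" using that l by (auto simp: disjoint_iff)
    thus ?thesis by (simp add: point_mass_sum_def)
  qed
  have ext: "?q A = 0" if "A \<notin> bounded_borel" for A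
    using that unfolding point_mass_sum_def by (rule if_not_P)
  show ?thesis unfolding complex_measures_Rplus_def
    using sums var supp ext by blast
qed

lemma discrete_measures_eq_range:
  assumes "ell > 0"
  shows "discrete_measures ell = range (point_mass_sum ell)"
  using point_mass_sum_in_measures[OF assms] by (auto simp: discrete_measures_def)

lemma schur_function_eq:
  assumes "weyl_function q z \<noteq> - \<i>"
  shows "schur_function q z = (weyl_function q z - \<i>) / (weyl_function q z + \<i>)"
proof -
  let ?m = "weyl_function q z"
  have ne: "?m + \<i> \<noteq> 0" using assms by (simp add: add_eq_0_iff2)
  have "(w \<noteq> 1 \<and> ?m = \<i> * ((1 + w) / (1 - w))) \<longleftrightarrow> w = (?m - \<i>) / (?m + \<i>)" for w
  proof -
    have "(?m - \<i>) / (?m + \<i>) \<noteq> 1" using ne by (simp add: field_simps)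
    moreover have "?m = \<i> * ((1 + w) / (1 - w)) \<longleftrightarrow> w = (?m - \<i>) / (?m + \<i>)" if "w \<noteq> 1"
    proof -
      have "?m = \<i> * ((1 + w) / (1 - w)) \<longleftrightarrow> ?m * (1 - w) = \<i> * (1 + w)"
        using that by (simp add: nonzero_eq_divide_eq)
      also have "\<dots> \<longleftrightarrow> w * (?m + \<i>) = ?m - \<i>" by (auto simp: algebra_simps)
      also have "\<dots> \<longleftrightarrow> w = (?m - \<i>) / (?m + \<i>)" using ne by (simp add: nonzero_eq_divide_eq)
      finally show ?thesis .
    qed
    ultimately show ?thesis by (cases "w = 1") auto
  qed
  thus ?thesis by (simp add: schur_function_def)
qed

end

theory Submission
  imports Defs "HOL-Computational_Algebra.Fundamental_Theorem_Algebra"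
begin

text \<open>
  Put \<open>\<zeta> = exp (2 * \<i> * ell * z)\<close>. For a potential concentrated on the lattice the Dirac
  system is solved by hand. Between two lattice points it is the constant coefficient system
  \<open>J N' = z N\<close>, whose flow is a rotation by the complex angle \<open>z\<close> times the length; at the
  lattice point \<open>ell * k\<close> the factor \<open>g(Q J\<^sup>*)\<close> in Persson's equation is exactly what makes the
  solution jump by the matrix exponential of the generator \<open>Q J\<^sup>*\<close>. So the solution is an
  alternating product of rotations and such exponentials (\<open>dirac_solution_point_masses\<close>).

  The Weyl quotient only sees the second row of the solution. In terms of the Cayley transform of
  the quotient of the two entries, multiplication of a row by a rotation over the length \<open>ell\<close>
  becomes multiplication by \<open>\<zeta>\<close>, and multiplication by the exponential for the weight \<open>c\<close>
  becomes the disk automorphism \<open>w \<mapsto> (w + a) / (1 + cnj a * w)\<close> with \<open>a = tanh |c| * cnj c / |c|\<close>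
  (\<open>row_schur_rotation\<close>, \<open>row_schur_kick\<close>). As \<open>varkappa\<close> is the inverse of \<open>c \<mapsto> a\<close>, the
  Schur function of the system is the limit of the compositions
  \<open>\<phi>\<^sub>0 (\<zeta> * \<phi>\<^sub>1 (\<zeta> * \<phi>\<^sub>2 (\<dots>)))\<close> of these automorphisms (\<open>schur_function_point_masses\<close>).

  This is the algorithm of Schur read backwards, and the theorem becomes the statement that
  sequences in the open disk correspond to functions in the Schur class of the disk other than
  finite Blaschke products. Two compositions of \<open>n\<close> automorphisms with the same parameters
  differ by \<open>\<zeta> ^ n\<close> times a holomorphic function, hence by at most \<open>2 * |\<zeta>| ^ n\<close>
  (\<open>schur_compose_contraction\<close>). This gives the convergence and also shows that a function is
  determined by its parameters (\<open>schur_chain_eq_limit\<close>). A function that is not a finite Blaschke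
  product can be divided for ever, since an automorphism applied to \<open>\<zeta>\<close> times a finite Blaschke
  product is again one (\<open>Blaschke_step_up\<close>). Conversely a finite Blaschke product is \<open>p / q\<close>
  with \<open>q\<close> the conjugate reversal of the polynomial \<open>p\<close>, and each division lowers the formal
  degree of the pair by one; a product with infinitely many parameters would end in a unimodular
  constant, which is impossible (\<open>schur_chain_not_Blaschke\<close>).
\<close>

(* From here on "$" only selects vector components. *)
no_notation fps_nth (infixl \<open>$\<close> 75)

section \<open>Automorphisms of the disk\<close>

definition disk_aut :: "complex \<Rightarrow> complex \<Rightarrow> complex" where
  "disk_aut a w = (w + a) / (1 + cnj a * w)"

lemma disk_aut_identity:
  "(norm (1 + cnj a * w))\<^sup>2 - (norm (w + a))\<^sup>2 = (1 - (norm a)\<^sup>2) * (1 - (norm w)\<^sup>2)"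
  unfolding cmod_power2 by (simp add: power2_eq_square algebra_simps)

lemma disk_aut_denominator:
  assumes "norm a < 1" "norm w \<le> 1"
  shows "1 + cnj a * w \<noteq> 0"
proof
  assume "1 + cnj a * w = 0"
  hence "norm (cnj a * w) = 1" by (metis add_eq_0_iff2 norm_minus_cancel norm_one)
  moreover have "norm (cnj a * w) \<le> norm a * 1"
    using assms by (simp add: norm_mult mult_left_le)
  ultimately show False using assms by simp
qed

lemma norm_disk_aut_le:
  assumes "norm a < 1" "norm w \<le> 1"
  shows "norm (disk_aut a w) \<le> 1"
proof -
  have "(norm a)\<^sup>2 \<le> 1" "(norm w)\<^sup>2 \<le> 1" using assms by (auto simp: power_le_one)
  hence "(norm (w + a))\<^sup>2 \<le> (norm (1 + cnj a * w))\<^sup>2"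
    using disk_aut_identity[of a w] by (smt (verit) mult_nonneg_nonneg)
  hence "norm (w + a) \<le> norm (1 + cnj a * w)" by (rule power2_le_imp_le) simp
  thus ?thesis using disk_aut_denominator[OF assms] by (simp add: disk_aut_def norm_divide divide_le_eq)
qed

lemma norm_disk_aut_less:
  assumes "norm a < 1" "norm w < 1"
  shows "norm (disk_aut a w) < 1"
proof -
  have "(norm a)\<^sup>2 < 1" "(norm w)\<^sup>2 < 1" using assms by (auto simp: power_less_one_iff abs_square_less_1)
  hence "0 < (1 - (norm a)\<^sup>2) * (1 - (norm w)\<^sup>2)" by simp
  hence "(norm (w + a))\<^sup>2 < (norm (1 + cnj a * w))\<^sup>2"
    using disk_aut_identity[of a w] by linarith
  hence "norm (w + a) < norm (1 + cnj a * w)" by (rule power2_less_imp_less) simp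
  thus ?thesis using disk_aut_denominator[of a w] assms
    by (simp add: disk_aut_def norm_divide divide_less_eq)
qed

lemma disk_aut_uminus_cancel:
  assumes "norm a < 1" "norm w \<le> 1"
  shows "disk_aut a (disk_aut (-a) w) = w"
proof -
  have d: "1 - cnj a * w \<noteq> 0" using disk_aut_denominator[of "-a" w] assms by simp
  have "1 - a * cnj a \<noteq> 0" using disk_aut_denominator[of "-a" a] assms by (simp add: mult.commute)
  have "disk_aut (-a) w + a = w * (1 - a * cnj a) / (1 - cnj a * w)"
    using d by (simp add: disk_aut_def field_simps)
  moreover have "1 + cnj a * disk_aut (-a) w = (1 - a * cnj a) / (1 - cnj a * w)"
    using d by (simp add: disk_aut_def field_simps)
  ultimately show ?thesis using \<open>1 - a * cnj a \<noteq> 0\<close> d by (simp add: disk_aut_def[of a])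
qed

lemma disk_aut_cancel_uminus:
  assumes "norm a < 1" "norm w \<le> 1"
  shows "disk_aut (-a) (disk_aut a w) = w"
  using disk_aut_uminus_cancel[of "-a" w] assms by simp

lemma disk_aut_diff:
  assumes "norm a < 1" "norm u \<le> 1" "norm v \<le> 1"
  shows "disk_aut a u - disk_aut a v
    = (u - v) * ((1 - a * cnj a) / ((1 + cnj a * u) * (1 + cnj a * v)))"
  using disk_aut_denominator[OF assms(1,2)] disk_aut_denominator[OF assms(1,3)]
  by (simp add: disk_aut_def divide_simps) (simp add: algebra_simps)

lemma holomorphic_disk_aut:
  assumes "norm a < 1" "g holomorphic_on S" "\<And>z. z \<in> S \<Longrightarrow> norm (g z) \<le> 1"
  shows "(\<lambda>z. disk_aut a (g z)) holomorphic_on S"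
  unfolding disk_aut_def
  by (intro holomorphic_intros assms(2)) (use assms(1,3) disk_aut_denominator in blast)

section \<open>Iterated disk automorphisms and their limit\<close>

definition schur_class :: "(complex \<Rightarrow> complex) set" where
  "schur_class = {F. F holomorphic_on ball 0 1 \<and> (\<forall>z\<in>ball 0 1. norm (F z) \<le> 1)}"

lemma schur_class_const: "norm c \<le> 1 \<Longrightarrow> (\<lambda>_. c) \<in> schur_class"
  by (simp add: schur_class_def)

lemma schur_class_bound: "F \<in> schur_class \<Longrightarrow> norm z < 1 \<Longrightarrow> norm (F z) \<le> 1"
  by (simp add: schur_class_def)

lemma schur_class_times:
  assumes "F \<in> schur_class" "norm z \<le> 1" "norm w < 1"
  shows "norm (z * F w) \<le> norm z"
  using schur_class_bound[OF assms(1,3)] by (simp add: norm_mult mult_left_le)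

lemma schur_class_disk_aut:
  assumes "norm a < 1" "g \<in> schur_class"
  shows "(\<lambda>z. disk_aut a (z * g z)) \<in> schur_class"
proof -
  have *: "norm (z * g z) \<le> 1" if "z \<in> ball 0 1" for z
    using schur_class_times[OF assms(2), of z z] that by simp
  have "(\<lambda>z. z * g z) holomorphic_on ball 0 1"
    using assms(2) by (auto simp: schur_class_def intro!: holomorphic_intros)
  from holomorphic_disk_aut[OF assms(1) this *] show ?thesis
    using * norm_disk_aut_le[OF assms(1)] by (simp add: schur_class_def)
qed

text \<open>
  The innermost function is left open: a constant yields the approximants of the limit, and the
  \<open>n\<close>-th iterate of a function under the algorithm of Schur yields that function itself.
\<close>

primrec schur_compose :: "nat \<Rightarrow> (nat \<Rightarrow> complex) \<Rightarrow> (complex \<Rightarrow> complex) \<Rightarrow> complex \<Rightarrow> complex" where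
  "schur_compose 0 a g \<zeta> = g \<zeta>"
| "schur_compose (Suc n) a g \<zeta> = disk_aut (a 0) (\<zeta> * schur_compose n (\<lambda>k. a (Suc k)) g \<zeta>)"

lemma schur_compose_add:
  "schur_compose (m + n) a g = schur_compose m a (schur_compose n (\<lambda>k. a (m + k)) g)"
  by (induction m arbitrary: a) (auto simp: fun_eq_iff)

lemma schur_compose_schur_class:
  assumes "\<And>k. norm (a k) < 1" "g \<in> schur_class"
  shows "schur_compose n a g \<in> schur_class"
  using assms(1)
proof (induction n arbitrary: a)
  case 0
  have "schur_compose 0 a g = g" by (simp add: fun_eq_iff)
  thus ?case using assms by simp
next
  case (Suc n)
  have "schur_compose (Suc n) a g
      = (\<lambda>\<zeta>. disk_aut (a 0) (\<zeta> * schur_compose n (\<lambda>k. a (Suc k)) g \<zeta>))"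
    by (simp add: fun_eq_iff)
  thus ?case using schur_class_disk_aut[of "a 0"] Suc by simp
qed

text \<open>
  The maximum principle on the circle of radius \<open>r\<close> gives the bound \<open>B / r ^ n\<close>, and \<open>r\<close> can be
  taken arbitrarily close to 1.
\<close>

lemma bounded_quotient_by_power:
  assumes h: "h holomorphic_on ball 0 1" and B: "\<And>z. z \<in> ball 0 1 \<Longrightarrow> norm (z ^ n * h z) \<le> B"
    and w: "w \<in> ball 0 1"
  shows "norm (h w) \<le> B"
proof -
  have bd: "norm (h w) * r ^ n \<le> B" if r: "norm w < r" "r < 1" for r
  proof -
    have r0: "0 < r" using r norm_ge_zero[of w] by linarith
    have "norm (h w) \<le> B / r ^ n"
    proof (rule maximum_modulus_frontier[of h "ball 0 r"])
      show "h holomorphic_on interior (ball 0 r)"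
        using r by (intro holomorphic_on_subset[OF h]) auto
      show "continuous_on (closure (ball 0 r)) h"
        using r r0 by (intro holomorphic_on_imp_continuous_on holomorphic_on_subset[OF h]) auto
      show "norm (h z) \<le> B / r ^ n" if "z \<in> frontier (ball 0 r)" for z
      proof -
        have z: "norm z = r" using that r0 by (simp add: dist_norm)
        have "norm (h z) * r ^ n \<le> B"
          using B[of z] z r by (simp add: norm_mult norm_power mult.commute)
        thus ?thesis using r0 by (simp add: field_simps)
      qed
    qed (use r in auto)
    thus ?thesis using r0 by (simp add: field_simps)
  qed
  have ev: "\<forall>\<^sub>F r in at_left 1. norm (h w) * r ^ n \<le> B"
    using eventually_at_left_real[of "norm w" 1] w
    by (auto elim!: eventually_mono intro: bd)
  have "((\<lambda>r. norm (h w) * r ^ n) \<longlongrightarrow> norm (h w) * 1 ^ n) (at_left (1::real))"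
    by (intro tendsto_intros)
  from tendsto_upperbound[OF this ev] show ?thesis by simp
qed

text \<open>
  Applying a disk automorphism to two functions multiplies their difference by a holomorphic
  factor, and the multiplication by the variable contributes one more zero at the origin at each
  level.
\<close>

lemma schur_compose_diff_factor:
  assumes "\<And>k. norm (a k) < 1" "g \<in> schur_class" "h \<in> schur_class"
  shows "\<exists>K. K holomorphic_on ball 0 1 \<and>
    (\<forall>z\<in>ball 0 1. schur_compose n a g z - schur_compose n a h z = z ^ n * K z)"
  using assms(1)
proof (induction n arbitrary: a)
  case 0
  show ?case using assms(2,3)
    by (intro exI[of _ "\<lambda>z. g z - h z"]) (auto simp: schur_class_def intro!: holomorphic_intros)
next
  case (Suc n)
  define G where "G = schur_compose n (\<lambda>k. a (Suc k)) g"
  define H where "H = schur_compose n (\<lambda>k. a (Suc k)) h"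
  obtain K where K: "K holomorphic_on ball 0 1" "\<And>z. z \<in> ball 0 1 \<Longrightarrow> G z - H z = z ^ n * K z"
    using Suc.IH[of "\<lambda>k. a (Suc k)"] Suc.prems unfolding G_def H_def by auto
  have GH: "G \<in> schur_class" "H \<in> schur_class"
    unfolding G_def H_def by (rule schur_compose_schur_class; use Suc.prems assms in simp)+
  have bd: "norm (z * G z) \<le> 1" "norm (z * H z) \<le> 1" if "z \<in> ball 0 1" for z
    using that schur_class_times[OF GH(1), of z z] schur_class_times[OF GH(2), of z z] by auto
  define L where "L = (\<lambda>z. K z * ((1 - a 0 * cnj (a 0)) /
     ((1 + cnj (a 0) * (z * G z)) * (1 + cnj (a 0) * (z * H z)))))"
  have "G holomorphic_on ball 0 1" "H holomorphic_on ball 0 1"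
    using GH by (auto simp: schur_class_def)
  hence "L holomorphic_on ball 0 1" unfolding L_def
    by (intro holomorphic_intros K) (use bd disk_aut_denominator[OF Suc.prems] in force)+
  moreover have "schur_compose (Suc n) a g z - schur_compose (Suc n) a h z = z ^ Suc n * L z"
    if z: "z \<in> ball 0 1" for z
  proof -
    have "schur_compose (Suc n) a g z - schur_compose (Suc n) a h z
        = (z * G z - z * H z) * ((1 - a 0 * cnj (a 0)) /
     ((1 + cnj (a 0) * (z * G z)) * (1 + cnj (a 0) * (z * H z))))"
      unfolding schur_compose.simps G_def[symmetric] H_def[symmetric]
      by (rule disk_aut_diff) (use Suc.prems bd z in auto)
    also have "z * G z - z * H z = z ^ Suc n * K z"
      using K(2)[OF z] by (simp flip: right_diff_distrib)
    finally show ?thesis by (simp add: L_def)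
  qed
  ultimately show ?case by blast
qed

text \<open>
  The holomorphic quotient of the previous lemma inherits the trivial bound 2 from the difference,
  because dividing by a power of the variable costs nothing.
\<close>

lemma schur_compose_contraction:
  assumes "\<And>k. norm (a k) < 1" "g \<in> schur_class" "h \<in> schur_class" "norm z < 1"
  shows "norm (schur_compose n a g z - schur_compose n a h z) \<le> 2 * norm z ^ n"
proof -
  obtain K where K: "K holomorphic_on ball 0 1"
    "\<And>z. z \<in> ball 0 1 \<Longrightarrow> schur_compose n a g z - schur_compose n a h z = z ^ n * K z"
    using schur_compose_diff_factor[of a g h n] assms by blast
  have "norm (z ^ n * K z) \<le> 2" if "z \<in> ball 0 1" for z
  proof -
    have "norm (schur_compose n a g z) \<le> 1" "norm (schur_compose n a h z) \<le> 1"
      using that schur_class_bound[OF schur_compose_schur_class] assms by auto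
    hence "norm (schur_compose n a g z - schur_compose n a h z) \<le> 2"
      using norm_triangle_ineq4[of "schur_compose n a g z" "schur_compose n a h z"] by linarith
    thus ?thesis using K(2)[OF that] by simp
  qed
  hence "norm (K z) \<le> 2" using bounded_quotient_by_power[OF K(1), of n 2 z] assms(4) by auto
  thus ?thesis using K(2)[of z] assms(4)
    by (simp add: norm_mult norm_power mult.commute mult_right_mono)
qed

definition schur_limit :: "(nat \<Rightarrow> complex) \<Rightarrow> complex \<Rightarrow> complex" where
  "schur_limit a z = lim (\<lambda>n. schur_compose n a (\<lambda>_. 0) z)"

lemma schur_compose_tendsto_limit:
  assumes a: "\<And>k. norm (a k) < 1" and z: "norm z < 1"
  shows "(\<lambda>n. schur_compose n a (\<lambda>_. 0) z) \<longlonglongrightarrow> schur_limit a z"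
proof -
  have step: "norm (schur_compose m a (\<lambda>_. 0) z - schur_compose n a (\<lambda>_. 0) z) \<le> 2 * norm z ^ m"
    if "m \<le> n" for m n
  proof -
    have "schur_compose n a (\<lambda>_. 0)
       = schur_compose m a (schur_compose (n - m) (\<lambda>k. a (m + k)) (\<lambda>_. 0))"
      using schur_compose_add[of m "n - m"] that by simp
    thus ?thesis
      by (simp, intro schur_compose_contraction schur_compose_schur_class schur_class_const)
         (use a z in auto)
  qed
  have "Cauchy (\<lambda>n. schur_compose n a (\<lambda>_. 0) z)"
  proof (rule metric_CauchyI)
    fix e :: real assume "e > 0"
    have "(\<lambda>m. 2 * norm z ^ m) \<longlonglongrightarrow> 2 * 0" using z by (intro tendsto_intros LIMSEQ_power_zero) auto
    hence "\<forall>\<^sub>F m in sequentially. 2 * norm z ^ m < e"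
      using order_tendstoD(2) \<open>e > 0\<close> by fastforce
    then obtain M where M: "\<And>m. m \<ge> M \<Longrightarrow> 2 * norm z ^ m < e"
      unfolding eventually_sequentially by blast
    have "dist (schur_compose m a (\<lambda>_. 0) z) (schur_compose n a (\<lambda>_. 0) z) < e"
      if "m \<ge> M" "n \<ge> M" for m n
      using step[of m n] step[of n m] M[of m] M[of n] that
      by (cases "m \<le> n") (auto simp: dist_norm norm_minus_commute)
    thus "\<exists>M. \<forall>m\<ge>M. \<forall>n\<ge>M. dist (schur_compose m a (\<lambda>_. 0) z) (schur_compose n a (\<lambda>_. 0) z) < e"
      by blast
  qed
  hence "convergent (\<lambda>n. schur_compose n a (\<lambda>_. 0) z)" by (rule Cauchy_convergent)
  thus ?thesis unfolding schur_limit_def convergent_LIMSEQ_iff .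
qed

lemma schur_compose_tendsto:
  assumes a: "\<And>k. norm (a k) < 1" and z: "norm z < 1" and g: "\<And>n. g n \<in> schur_class"
  shows "(\<lambda>n. schur_compose n a (g n) z) \<longlonglongrightarrow> schur_limit a z"
proof -
  have "(\<lambda>n. schur_compose n a (g n) z - schur_compose n a (\<lambda>_. 0) z) \<longlonglongrightarrow> 0"
  proof (rule tendsto_norm_zero_cancel, rule tendsto_sandwich[of "\<lambda>_. 0" _ _ "\<lambda>n. 2 * norm z ^ n"])
    show "(\<lambda>n. 2 * norm z ^ n) \<longlonglongrightarrow> 0"
      using z by (intro tendsto_mult_right_zero LIMSEQ_power_zero) auto
    show "\<forall>\<^sub>F n in sequentially.
        norm (schur_compose n a (g n) z - schur_compose n a (\<lambda>_. 0) z) \<le> 2 * norm z ^ n"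
      using schur_compose_contraction[of a, OF a g schur_class_const z] by simp
  qed simp_all
  from tendsto_add[OF this schur_compose_tendsto_limit[of a, OF a z]] show ?thesis by simp
qed

text \<open>
  Both sides of the recursion for the approximants converge.
\<close>

lemma schur_limit_rec:
  assumes a: "\<And>k. norm (a k) < 1" and z: "norm z < 1"
  shows "schur_limit a z = disk_aut (a 0) (z * schur_limit (\<lambda>k. a (Suc k)) z)"
proof -
  let ?b = "\<lambda>k. a (Suc k)"
  have conv: "(\<lambda>n. schur_compose n ?b (\<lambda>_. 0) z) \<longlonglongrightarrow> schur_limit ?b z"
    by (rule schur_compose_tendsto_limit) (use a z in auto)
  have "norm (schur_compose n ?b (\<lambda>_. 0) z) \<le> 1" for n
    by (rule schur_class_bound[OF schur_compose_schur_class]) (use a z schur_class_const in auto)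
  hence "norm (schur_limit ?b z) \<le> 1"
    by (intro LIMSEQ_le_const2[OF tendsto_norm[OF conv]]) auto
  hence "norm (z * schur_limit ?b z) \<le> 1"
    using z by (simp add: norm_mult mult_le_one)
  hence "1 + cnj (a 0) * (z * schur_limit ?b z) \<noteq> 0"
    by (rule disk_aut_denominator[OF a])
  hence "(\<lambda>n. schur_compose (Suc n) a (\<lambda>_. 0) z) \<longlonglongrightarrow> disk_aut (a 0) (z * schur_limit ?b z)"
    unfolding schur_compose.simps disk_aut_def by (intro tendsto_intros conv)
  moreover have "(\<lambda>n. schur_compose (Suc n) a (\<lambda>_. 0) z) \<longlonglongrightarrow> schur_limit a z"
    using schur_compose_tendsto_limit[of a, OF a z] by (rule LIMSEQ_Suc)
  ultimately show ?thesis by (rule LIMSEQ_unique[symmetric])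
qed

text \<open>
  The contraction estimate also bounds the distance to the limit, so the convergence is uniform on
  compact subsets of the disk and holomorphy passes to the limit.
\<close>

lemma schur_limit_schur_class:
  assumes a: "\<And>k. norm (a k) < 1"
  shows "schur_limit a \<in> schur_class"
proof -
  let ?S = "\<lambda>n. schur_compose n a (\<lambda>_. 0)"
  have cls: "?S n \<in> schur_class" for n by (intro schur_compose_schur_class a schur_class_const) auto
  have bd: "norm (schur_limit a z) \<le> 1" if "norm z < 1" for z
    using schur_class_bound[OF cls that]
    by (intro LIMSEQ_le_const2[OF tendsto_norm[OF schur_compose_tendsto_limit[of a, OF a that]]]) auto
  have est: "norm (?S n z - schur_limit a z) \<le> 2 * norm z ^ n" if z: "norm z < 1" for n z
  proof -
    have "(\<lambda>m. norm (?S n z - ?S (n + m) z)) \<longlonglongrightarrow> norm (?S n z - schur_limit a z)"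
      using LIMSEQ_ignore_initial_segment[OF schur_compose_tendsto_limit[of a, OF a z], of n]
      by (intro tendsto_intros) (simp add: add.commute)
    moreover have "norm (?S n z - ?S (n + m) z) \<le> 2 * norm z ^ n" for m
      unfolding schur_compose_add
      by (intro schur_compose_contraction schur_compose_schur_class schur_class_const a z) auto
    ultimately show ?thesis by (intro LIMSEQ_le_const2) auto
  qed
  have "schur_limit a holomorphic_on ball 0 1"
  proof (rule holomorphic_uniform_sequence[where f = ?S])
    show "?S n holomorphic_on ball 0 1" for n using cls[of n] by (simp add: schur_class_def)
    fix x :: complex assume x: "x \<in> ball 0 1"
    define d where "d = (1 - norm x) / 2"
    have d: "d > 0" "norm x + d < 1" using x by (auto simp: d_def field_simps)
    have nz: "norm z \<le> norm x + d" if "z \<in> cball x d" for z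
      using that norm_triangle_sub[of z x] by (simp add: dist_norm norm_minus_commute)
    have "uniform_limit (cball x d) ?S (schur_limit a) sequentially"
    proof (rule uniform_limitI)
      fix e :: real assume "e > 0"
      have "(\<lambda>n. 2 * (norm x + d) ^ n) \<longlonglongrightarrow> 2 * 0"
        using d by (intro tendsto_intros LIMSEQ_power_zero) auto
      hence "\<forall>\<^sub>F n in sequentially. 2 * (norm x + d) ^ n < e"
        using order_tendstoD(2) \<open>e > 0\<close> by fastforce
      thus "\<forall>\<^sub>F n in sequentially. \<forall>z\<in>cball x d. dist (?S n z) (schur_limit a z) < e"
      proof eventually_elim
        case (elim n)
        show ?case
        proof
          fix z assume z: "z \<in> cball x d"
          have "norm (?S n z - schur_limit a z) \<le> 2 * norm z ^ n"
            using est[of z n] nz[OF z] d by simp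
          also have "\<dots> \<le> 2 * (norm x + d) ^ n"
            using nz[OF z] by (simp add: power_mono)
          finally show "dist (?S n z) (schur_limit a z) < e" using elim by (simp add: dist_norm)
        qed
      qed
    qed
    moreover have "cball x d \<subseteq> ball 0 1" using nz d by force
    ultimately show "\<exists>d>0. cball x d \<subseteq> ball 0 1 \<and> uniform_limit (cball x d) ?S (schur_limit a) sequentially"
      using d by blast
  qed simp
  thus ?thesis using bd by (simp add: schur_class_def)
qed

lemma schur_limit_norm_less:
  assumes a: "\<And>k. norm (a k) < 1" and z: "norm z < 1"
  shows "norm (schur_limit a z) < 1"
proof -
  have "schur_limit (\<lambda>k. a (Suc k)) \<in> schur_class" by (rule schur_limit_schur_class) (rule a)
  hence "norm (z * schur_limit (\<lambda>k. a (Suc k)) z) < 1"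
    using schur_class_times[of _ z z] z by fastforce
  thus ?thesis using schur_limit_rec[of a, OF a z] norm_disk_aut_less[OF a] by simp
qed

lemma schur_limit_0:
  assumes "\<And>k. norm (a k) < 1"
  shows "schur_limit a 0 = a 0"
  using schur_limit_rec[of a 0, OF assms] by (simp add: disk_aut_def)

lemma schur_limit_unfold:
  assumes a: "\<And>k. norm (a k) < 1" and z: "norm z < 1"
  shows "schur_limit a z = schur_compose n a (schur_limit (\<lambda>k. a (n + k))) z"
  using a
proof (induction n arbitrary: a)
  case (Suc n)
  show ?case using schur_limit_rec[of a z, OF Suc.prems z] Suc.IH[of "\<lambda>k. a (Suc k)"] Suc.prems by simp
qed simp

section \<open>The algorithm of Schur\<close>

text \<open>
  The quotient has a removable singularity at the origin, where its value is the derivative of the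
  numerator. With the value given by division by zero the function need not be holomorphic.
\<close>

definition schur_step :: "(complex \<Rightarrow> complex) \<Rightarrow> complex \<Rightarrow> complex" where
  "schur_step F = (\<lambda>z. let h = (\<lambda>z. disk_aut (- F 0) (F z)) in if z = 0 then deriv h 0 else h z / z)"

text \<open>
  Otherwise the maximum principle makes the function a unimodular constant, which is a finite
  Blaschke product without factors.
\<close>

lemma schur_class_norm_less:
  assumes F: "F \<in> schur_class" and nc: "\<not> finite_Blaschke_product F" and z: "norm z < 1"
  shows "norm (F z) < 1"
proof (rule ccontr)
  assume "\<not> norm (F z) < 1"
  hence Fz: "norm (F z) = 1" using schur_class_bound[OF F z] by simp
  have "F constant_on ball 0 1"
    by (rule maximum_modulus_principle[of F "ball 0 1" "ball 0 1" z])
       (use F z Fz in \<open>auto simp: schur_class_def\<close>)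
  then obtain u where u: "\<And>w. w \<in> ball 0 1 \<Longrightarrow> F w = u" by (auto simp: constant_on_def)
  hence "finite_Blaschke_product F" unfolding finite_Blaschke_product_def
    using Fz z by (intro exI[of _ u] exI[of _ "[]"]) auto
  thus False using nc by contradiction
qed

text \<open>
  Composed with the automorphism that moves its value at the origin to 0, the function satisfies
  the hypotheses of the Schwarz lemma; the bounds there are the bounds for the quotient.
\<close>

lemma schur_step:
  assumes F: "F \<in> schur_class" and lt: "\<And>z. norm z < 1 \<Longrightarrow> norm (F z) < 1"
  shows "schur_step F \<in> schur_class"
    and "norm z < 1 \<Longrightarrow> F z = disk_aut (F 0) (z * schur_step F z)"
proof -
  define h where "h = (\<lambda>z. disk_aut (- F 0) (F z))"
  have h0: "h 0 = 0" by (simp add: h_def disk_aut_def)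
  have hol: "h holomorphic_on ball 0 1" unfolding h_def
    by (rule holomorphic_disk_aut) (use F lt in \<open>auto simp: schur_class_def\<close>)
  have hlt: "norm (h z) < 1" if "norm z < 1" for z
    unfolding h_def using that lt by (intro norm_disk_aut_less) auto
  have G: "schur_step F = (\<lambda>z. if z = 0 then deriv h 0 else (h z - h 0) / (z - 0))"
    by (simp add: schur_step_def h_def[symmetric] h0 Let_def fun_eq_iff)
  have "schur_step F holomorphic_on ball 0 1" unfolding G by (rule pole_lemma[OF hol]) simp
  moreover have "norm (schur_step F z) \<le> 1" if "norm z < 1" for z
    using Schwarz_Lemma(1,2)[OF hol h0 hlt that] that
    by (auto simp: G h0 norm_divide divide_le_eq)
  ultimately show "schur_step F \<in> schur_class" by (simp add: schur_class_def)
  assume z: "norm z < 1"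
  have "z * schur_step F z = h z" by (simp add: G h0)
  thus "F z = disk_aut (F 0) (z * schur_step F z)"
    unfolding h_def using disk_aut_uminus_cancel[of "F 0" "F z"] lt[of 0] lt[OF z] by simp
qed

text \<open>
  For each \<open>n\<close> the first function is the composition of \<open>n\<close> automorphisms with \<open>Fs n\<close> as
  innermost function, and the choice of the innermost functions does not influence the limit.
\<close>

lemma schur_chain_eq_limit:
  assumes cls: "\<And>k. Fs k \<in> schur_class" and lt: "\<And>k. norm (Fs k 0) < 1"
    and step: "\<And>k z. norm z < 1 \<Longrightarrow> Fs k z = disk_aut (Fs k 0) (z * Fs (Suc k) z)"
    and z: "norm z < 1"
  shows "Fs 0 z = schur_limit (\<lambda>k. Fs k 0) z"
proof -
  have comp: "schur_compose n (\<lambda>k. Fs (m + k) 0) (Fs (m + n)) z = Fs m z" for n m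
  proof (induction n arbitrary: m)
    case (Suc n)
    show ?case using Suc[of "Suc m"] step[OF z, of m] by simp
  qed simp
  have "(\<lambda>n. schur_compose n (\<lambda>k. Fs k 0) (Fs n) z) \<longlonglongrightarrow> schur_limit (\<lambda>k. Fs k 0) z"
    by (intro schur_compose_tendsto lt cls z)
  moreover have "schur_compose n (\<lambda>k. Fs k 0) (Fs n) z = Fs 0 z" for n
    using comp[of n 0] by simp
  ultimately have "(\<lambda>n. Fs 0 z) \<longlonglongrightarrow> schur_limit (\<lambda>k. Fs k 0) z" by simp
  thus ?thesis by (rule LIMSEQ_unique[OF tendsto_const])
qed

text \<open>
  In the variable \<open>exp (2 * \<i> * ell * z)\<close> the limit along the imaginary axis is the value at the
  origin, so the iteration on the half plane is the algorithm of Schur on the disk.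
\<close>

lemma schur_iterate_chain:
  assumes ell: "ell > 0"
    and cls: "\<And>k. Fs k \<in> schur_class" and lt: "\<And>k. norm (Fs k 0) < 1"
    and step: "\<And>k z. norm z < 1 \<Longrightarrow> Fs k z = disk_aut (Fs k 0) (z * Fs (Suc k) z)"
    and f: "\<And>z. Im z > 0 \<Longrightarrow> f z = Fs 0 (exp (2 * \<i> * of_real ell * z))"
  shows "recurrence_coeff ell f k = Fs k 0"
proof -
  let ?e = "\<lambda>z. exp (2 * \<i> * of_real ell * z)"
  have e1: "norm (?e z) < 1" if "Im z > 0" for z using that ell by simp
  have val: "value_at_i_infinity g = G 0"
    if g: "\<And>z. Im z > 0 \<Longrightarrow> g z = G (?e z)" and G: "G \<in> schur_class" for g G
  proof -
    have "filterlim (\<lambda>y. - (2 * ell * y)) at_bot at_top"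
      unfolding filterlim_uminus_at_bot minus_minus using ell
      by (intro filterlim_tendsto_pos_mult_at_top[OF tendsto_const] filterlim_ident) auto
    hence "((\<lambda>y. exp (- (2 * ell * y))) \<longlongrightarrow> 0) at_top"
      by (rule filterlim_compose[OF exp_at_bot])
    hence "((\<lambda>y. complex_of_real (exp (- (2 * ell * y)))) \<longlongrightarrow> of_real 0) at_top"
      by (rule tendsto_of_real)
    moreover have "complex_of_real (exp (- (2 * ell * y))) = ?e (\<i> * of_real y)" for y
    proof -
      have "2 * \<i> * of_real ell * (\<i> * of_real y) = complex_of_real (- (2 * ell * y))"
        by (simp add: complex_eq_iff)
      thus ?thesis by (simp only: exp_of_real)
    qed
    ultimately have *: "((\<lambda>y::real. ?e (\<i> * of_real y)) \<longlongrightarrow> 0) at_top" by simp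
    have "isCont G 0" using G
      by (intro continuous_on_interior[of "ball 0 1"]) (auto simp: schur_class_def holomorphic_on_imp_continuous_on)
    from isCont_tendsto_compose[OF this *]
    have "((\<lambda>y. G (?e (\<i> * of_real y))) \<longlongrightarrow> G 0) at_top" .
    moreover have "\<forall>\<^sub>F y in at_top. G (?e (\<i> * of_real y)) = g (\<i> * of_real y)"
      using eventually_gt_at_top[of 0] by eventually_elim (simp add: g)
    ultimately have "((\<lambda>y::real. g (\<i> * of_real y)) \<longlongrightarrow> G 0) at_top"
      by (rule Lim_transform_eventually)
    thus ?thesis unfolding value_at_i_infinity_def by (rule tendsto_Lim[rotated]) simp
  qed
  have "Im z > 0 \<Longrightarrow> schur_iterate ell f k z = Fs k (?e z)" for z
  proof (induction k arbitrary: z)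
    case (Suc k)
    define u where "u = ?e z * Fs (Suc k) (?e z)"
    have nu: "norm u \<le> 1" unfolding u_def
      using schur_class_times[OF cls[of "Suc k"], of "?e z" "?e z"] e1[OF Suc.prems] by linarith
    have v: "value_at_i_infinity (schur_iterate ell f k) = Fs k 0"
      by (rule val[OF Suc.IH cls])
    have "schur_iterate ell f (Suc k) z = disk_aut (- Fs k 0) (Fs k (?e z)) / ?e z"
      using v Suc.IH[OF Suc.prems] by (simp add: Let_def disk_aut_def)
    also have "Fs k (?e z) = disk_aut (Fs k 0) u"
      unfolding u_def by (rule step[OF e1[OF Suc.prems]])
    also have "disk_aut (- Fs k 0) (disk_aut (Fs k 0) u) = u"
      by (rule disk_aut_cancel_uminus[OF lt nu])
    finally show ?case by (simp add: u_def)
  qed (simp add: f)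
  from val[OF this cls] show ?thesis by (simp add: recurrence_coeff_def)
qed

section \<open>Finite Blaschke products\<close>

text \<open>
  Here \<open>q\<close> is the conjugate reversal of \<open>p\<close> regarded as a polynomial of formal degree \<open>n\<close>,
  which may exceed the degree of \<open>p\<close>. The formal degree is what counts the steps of the algorithm
  of Schur.
\<close>

definition reflected_pair :: "nat \<Rightarrow> complex poly \<Rightarrow> complex poly \<Rightarrow> bool" where
  "reflected_pair n p q \<longleftrightarrow> degree p \<le> n \<and> degree q \<le> n \<and> (\<forall>i\<le>n. coeff q i = cnj (coeff p (n - i)))"

lemma reflected_pairD:
  assumes "reflected_pair n p q"
  shows "coeff q i = (if i \<le> n then cnj (coeff p (n - i)) else 0)"
    and "coeff p i = (if i \<le> n then cnj (coeff q (n - i)) else 0)"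
  using assms by (auto simp: reflected_pair_def coeff_eq_0)

lemma reflected_pairI:
  assumes "\<And>i. coeff q i = (if i \<le> n then cnj (coeff p (n - i)) else 0)" "degree p \<le> n"
  shows "reflected_pair n p q"
  using assms by (auto simp: reflected_pair_def intro!: degree_le)

lemma poly_eq_sum_atMost:
  fixes p :: "'a::comm_semiring_1 poly"
  assumes "degree p \<le> n"
  shows "poly p x = (\<Sum>i\<le>n. coeff p i * x ^ i)"
  by (subst poly_altdef, rule sum.mono_neutral_left) (use assms in \<open>auto simp: coeff_eq_0\<close>)

lemma poly_reflected:
  assumes "reflected_pair n p q" "z \<noteq> 0"
  shows "poly q z = z ^ n * cnj (poly p (1 / cnj z))"
proof -
  have "poly q z = (\<Sum>i\<le>n. coeff q i * z ^ i)"
    using assms(1) by (intro poly_eq_sum_atMost) (auto simp: reflected_pair_def)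
  also have "\<dots> = (\<Sum>i\<le>n. cnj (coeff p (n - i)) * z ^ i)"
    using assms(1) by (intro sum.cong) (auto simp: reflected_pair_def)
  also have "\<dots> = (\<Sum>i\<le>n. cnj (coeff p i) * z ^ (n - i))"
    by (rule sum.reindex_bij_witness[of _ "\<lambda>i. n - i" "\<lambda>i. n - i"]) auto
  also have "\<dots> = z ^ n * cnj (\<Sum>i\<le>n. coeff p i * (1 / cnj z) ^ i)"
    using assms(2) by (auto simp: sum_distrib_left power_diff field_simps intro!: sum.cong)
  also have "(\<Sum>i\<le>n. coeff p i * (1 / cnj z) ^ i) = poly p (1 / cnj z)"
    using assms(1) by (intro poly_eq_sum_atMost[symmetric]) (auto simp: reflected_pair_def)
  finally show ?thesis .
qed

lemma norm_poly_reflected: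
  assumes "reflected_pair n p q" "norm z = 1"
  shows "norm (poly q z) = norm (poly p z)"
proof -
  have z: "z \<noteq> 0" using assms(2) by auto
  have "1 / cnj z = z" using assms(2) z
    by (simp add: field_simps complex_norm_square[symmetric] flip: power2_eq_square)
  thus ?thesis using poly_reflected[OF assms(1) z] assms(2) by (simp add: norm_mult norm_power)
qed

text \<open>
  A disk automorphism applied to \<open>p / q\<close> replaces the pair by this linear combination.
\<close>

lemma reflected_pair_combine:
  assumes "reflected_pair n p q"
  shows "reflected_pair n (p + smult a q) (q + smult (cnj a) p)"
  using assms unfolding reflected_pair_def
  by (auto intro!: degree_add_le degree_smult_le[THEN order_trans] simp: coeff_eq_0)

lemma reflected_pair_pCons:
  "reflected_pair n p q \<longleftrightarrow> reflected_pair (Suc n) (pCons 0 p) q"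
proof
  assume *: "reflected_pair n p q"
  show "reflected_pair (Suc n) (pCons 0 p) q"
  proof (rule reflected_pairI)
    show "coeff q i = (if i \<le> Suc n then cnj (coeff (pCons 0 p) (Suc n - i)) else 0)" for i
      using reflected_pairD(1)[OF *, of i] by (auto simp: Suc_diff_le le_Suc_eq)
  qed (use * degree_pCons_le[of 0 p] in \<open>auto simp: reflected_pair_def\<close>)
next
  assume *: "reflected_pair (Suc n) (pCons 0 p) q"
  show "reflected_pair n p q"
  proof (rule reflected_pairI)
    show "coeff q i = (if i \<le> n then cnj (coeff p (n - i)) else 0)" for i
      using reflected_pairD(1)[OF *, of i] by (auto simp: Suc_diff_le le_Suc_eq)
    show "degree p \<le> n" using * by (cases "p = 0") (auto simp: reflected_pair_def)
  qed
qed

text \<open>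
  Multiplying \<open>p\<close> by the linear factor with root \<open>a\<close> multiplies \<open>q\<close> by the reflected factor, and
  the formal degree grows by one.
\<close>

lemma reflected_pair_linear_factor:
  assumes "reflected_pair n p q"
  shows "reflected_pair (Suc n) (pCons 0 p - smult a p) (q - smult (cnj a) (pCons 0 q))"
proof (rule reflected_pairI)
  show "coeff (q - smult (cnj a) (pCons 0 q)) i
      = (if i \<le> Suc n then cnj (coeff (pCons 0 p - smult a p) (Suc n - i)) else 0)" for i
    using reflected_pairD(1)[OF assms, of i] reflected_pairD(1)[OF assms, of "i - 1"]
      reflected_pairD(2)[OF assms, of "Suc n"]
    by (cases "i \<le> n") (auto simp: coeff_pCons Suc_diff_le le_Suc_eq Suc_diff_Suc split: nat.splits)
  show "degree (pCons 0 p - smult a p) \<le> Suc n"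
    using assms degree_pCons_le[of 0 p] degree_smult_le[of a p]
    by (intro degree_diff_le) (auto simp: reflected_pair_def)
qed

definition blaschke_pair :: "(complex \<Rightarrow> complex) \<Rightarrow> nat \<Rightarrow> complex poly \<Rightarrow> complex poly \<Rightarrow> bool" where
  "blaschke_pair F n p q \<longleftrightarrow> reflected_pair n p q \<and> (\<forall>z\<in>cball 0 1. poly q z \<noteq> 0) \<and>
     (\<forall>z\<in>ball 0 1. F z * poly q z = poly p z)"

text \<open>
  By the fundamental theorem of algebra \<open>p\<close> splits into linear factors. A root on or outside the
  unit circle would be reflected to a root of \<open>q\<close> in the closed disk, so all roots lie in the
  open disk, and the reflected factors are those of \<open>q\<close>.
\<close>

lemma reflected_quotient_is_Blaschke:
  assumes "blaschke_pair F n p q"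
  shows "finite_Blaschke_product F"
proof -
  have r: "reflected_pair n p q" and q0: "\<And>z. norm z \<le> 1 \<Longrightarrow> poly q z \<noteq> 0"
    and F: "\<And>z. norm z < 1 \<Longrightarrow> F z * poly q z = poly p z"
    using assms by (auto simp: blaschke_pair_def)
  have "coeff q 0 \<noteq> 0" using q0[of 0] by (simp add: poly_0_coeff_0)
  hence "coeff p n \<noteq> 0" using r by (auto simp: reflected_pair_def)
  hence deg: "degree p = n" using r le_degree by (fastforce simp: reflected_pair_def)
  obtain as where as: "mset as = proots p" using ex_mset by blast
  have dec: "p = smult (lead_coeff p) (\<Prod>x\<leftarrow>as. [:-x, 1:])"
    using complex_poly_decompose_multiset[of p]
    by (simp add: as[symmetric] flip: prod_mset_prod_list)
  have len: "length as = degree p" using size_proots_complex[of p] by (simp flip: as)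
  have lc: "lead_coeff p \<noteq> 0" using \<open>coeff p n \<noteq> 0\<close> deg by simp
  have pz: "poly p z = lead_coeff p * (\<Prod>x\<leftarrow>as. z - x)" for z
  proof -
    have "poly p z = lead_coeff p * poly (\<Prod>x\<leftarrow>as. [:-x, 1:]) z"
      by (subst dec) simp
    also have "poly (\<Prod>x\<leftarrow>as. [:-x, 1:]) z = (\<Prod>x\<leftarrow>as. z - x)"
      by (induction as) (auto simp: algebra_simps)
    finally show ?thesis .
  qed
  have roots: "norm x < 1" if "x \<in> set as" for x
  proof (rule ccontr)
    assume nx: "\<not> norm x < 1"
    hence x0: "x \<noteq> 0" by auto
    have "poly p x = 0" unfolding pz using that by (auto simp: prod_list_zero_iff)
    hence "poly q (1 / cnj x) = 0"
      using poly_reflected[OF r, of "1 / cnj x"] x0 by simp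
    moreover have "norm (1 / cnj x) \<le> 1" using nx by (simp add: norm_divide divide_le_eq)
    ultimately show False using q0 by blast
  qed
  have qz: "poly q z = cnj (lead_coeff p) * (\<Prod>x\<leftarrow>as. 1 - cnj x * z)" for z
  proof (cases "z = 0")
    case True
    have "(\<Prod>x\<leftarrow>as. 1 - cnj x * 0) = 1" by (induction as) auto
    thus ?thesis using True r deg by (simp add: poly_0_coeff_0 reflected_pair_def)
  next
    case False
    have "z ^ length xs * (\<Prod>x\<leftarrow>xs. 1 / z - cnj x) = (\<Prod>x\<leftarrow>xs. 1 - cnj x * z)" for xs
      using False by (induction xs) (auto simp: field_simps)
    moreover have "cnj (\<Prod>x\<leftarrow>xs. 1 / cnj z - x) = (\<Prod>x\<leftarrow>xs. 1 / z - cnj x)" for xs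
      by (induction xs) auto
    ultimately show ?thesis
      using poly_reflected[OF r False] len deg by (simp add: pz mult.left_commute) metis
  qed
  define u where "u = lead_coeff p / cnj (lead_coeff p)"
  have "norm u = 1" using lc by (simp add: u_def norm_divide)
  moreover have "F z = u * (\<Prod>a\<leftarrow>as. (z - a) / (1 - cnj a * z))" if z: "norm z < 1" for z
  proof -
    have *: "(\<Prod>a\<leftarrow>xs. (z - a) / (1 - cnj a * z)) = (\<Prod>x\<leftarrow>xs. z - x) / (\<Prod>x\<leftarrow>xs. 1 - cnj x * z)" for xs
      by (induction xs) auto
    have "F z = poly p z / poly q z" using F[OF z] q0[of z] z by (simp add: field_simps)
    thus ?thesis by (simp only: pz qz * u_def times_divide_times_eq)
  qed
  ultimately show ?thesis unfolding finite_Blaschke_product_def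
    using roots by (intro exI[of _ u] exI[of _ as]) auto
qed

text \<open>
  The unimodular constant \<open>u\<close> is distributed over numerator and denominator by means of a square
  root \<open>v\<close>: then \<open>u = v / cnj v\<close>.
\<close>

lemma Blaschke_imp_pair:
  assumes "finite_Blaschke_product F"
  shows "\<exists>n p q. blaschke_pair F n p q"
proof -
  obtain u as where u: "norm u = 1" and as: "\<And>a. a \<in> set as \<Longrightarrow> norm a < 1"
    and F: "\<And>z. norm z < 1 \<Longrightarrow> F z = u * (\<Prod>a\<leftarrow>as. (z - a) / (1 - cnj a * z))"
    using assms unfolding finite_Blaschke_product_def by force
  have "\<exists>n p q. blaschke_pair (\<lambda>z. u * (\<Prod>a\<leftarrow>as. (z - a) / (1 - cnj a * z))) n p q"
    using as
  proof (induction as)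
    case Nil
    let ?v = "csqrt u"
    have v2: "?v\<^sup>2 = u" by simp
    have nv: "norm ?v = 1" using u by simp
    have "?v * cnj ?v = 1" using nv by (simp add: complex_norm_square[symmetric])
    hence "u * cnj ?v = ?v" using v2 by (metis mult.assoc mult.right_neutral power2_eq_square)
    moreover have "?v \<noteq> 0" using nv by force
    ultimately show ?case
      by (intro exI[of _ 0] exI[of _ "[:?v:]"] exI[of _ "[:cnj ?v:]"])
         (simp add: blaschke_pair_def reflected_pair_def)
  next
    case (Cons a as)
    then obtain n p q where IH: "blaschke_pair (\<lambda>z. u * (\<Prod>a\<leftarrow>as. (z - a) / (1 - cnj a * z))) n p q"
      by auto
    have a: "norm a < 1" using Cons.prems by simp
    have nz: "1 - cnj a * z \<noteq> 0" if "norm z \<le> 1" for z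
      using disk_aut_denominator[of "-a" z] a that by simp
    let ?p = "pCons 0 p - smult a p" and ?q = "q - smult (cnj a) (pCons 0 q)"
    have pq: "poly ?p z = (z - a) * poly p z" "poly ?q z = (1 - cnj a * z) * poly q z" for z
      by (simp_all add: algebra_simps)
    have "blaschke_pair (\<lambda>z. u * (\<Prod>a\<leftarrow>a # as. (z - a) / (1 - cnj a * z))) (Suc n) ?p ?q"
      unfolding blaschke_pair_def
    proof (intro conjI ballI)
      show "reflected_pair (Suc n) ?p ?q"
        using IH by (intro reflected_pair_linear_factor) (simp add: blaschke_pair_def)
      show "poly ?q z \<noteq> 0" if "z \<in> cball 0 1" for z
        using that IH nz[of z] unfolding pq by (simp add: blaschke_pair_def)
      fix z :: complex assume z: "z \<in> ball 0 1"
      have "u * (\<Prod>a\<leftarrow>as. (z - a) / (1 - cnj a * z)) * poly q z = poly p z"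
        using IH z by (simp add: blaschke_pair_def)
      thus "u * (\<Prod>a\<leftarrow>a # as. (z - a) / (1 - cnj a * z)) * poly ?q z = poly ?p z"
        unfolding pq using nz[of z] z by (simp add: mult.assoc)
    qed
    thus ?case by blast
  qed
  then obtain n p q where "blaschke_pair (\<lambda>z. u * (\<Prod>a\<leftarrow>as. (z - a) / (1 - cnj a * z))) n p q"
    by blast
  hence "blaschke_pair F n p q" using F by (simp add: blaschke_pair_def)
  thus ?thesis by blast
qed

text \<open>
  The new denominator has no zero in the closed disk because \<open>|p| \<le> |q|\<close> there, with equality on
  the circle.
\<close>

lemma Blaschke_step_up:
  assumes G: "finite_Blaschke_product G" "G \<in> schur_class" and a: "norm a < 1"
    and F: "\<And>z. norm z < 1 \<Longrightarrow> F z = disk_aut a (z * G z)"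
  shows "finite_Blaschke_product F"
proof -
  obtain n p q where pair: "blaschke_pair G n p q" using Blaschke_imp_pair[OF G(1)] by blast
  hence r: "reflected_pair n p q" and q0: "\<And>z. norm z \<le> 1 \<Longrightarrow> poly q z \<noteq> 0"
    and Gz: "\<And>z. norm z < 1 \<Longrightarrow> G z * poly q z = poly p z"
    by (auto simp: blaschke_pair_def)
  let ?p = "pCons 0 p + smult a q" and ?q = "q + smult (cnj a) (pCons 0 p)"
  have le: "norm (z * poly p z) \<le> norm (poly q z)" if "norm z \<le> 1" for z
  proof -
    have "norm (poly p z) \<le> norm (poly q z)"
    proof (cases "norm z = 1")
      case False
      hence "norm z < 1" using that by simp
      thus ?thesis using Gz[of z] schur_class_bound[OF G(2), of z]
        by (metis mult_left_le_one_le norm_ge_zero norm_mult)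
    qed (simp add: norm_poly_reflected[OF r])
    thus ?thesis using that by (metis mult_left_le_one_le norm_ge_zero norm_mult order_trans)
  qed
  have "blaschke_pair F (Suc n) ?p ?q" unfolding blaschke_pair_def
  proof (intro conjI ballI)
    show "reflected_pair (Suc n) ?p ?q"
      using r reflected_pair_combine reflected_pair_pCons by blast
    show "poly ?q z \<noteq> 0" if "z \<in> cball 0 1" for z
    proof
      assume "poly ?q z = 0"
      hence "poly q z = - (cnj a * (z * poly p z))" by (simp add: add_eq_0_iff2)
      hence "norm (poly q z) = norm a * norm (z * poly p z)" by (simp add: norm_mult)
      also have "\<dots> \<le> norm a * norm (poly q z)" using le that by (intro mult_left_mono) auto
      finally have "(1 - norm a) * norm (poly q z) \<le> 0" by (simp add: algebra_simps)
      thus False using a q0[of z] that by (simp add: mult_le_0_iff)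
    qed
    fix z :: complex assume z: "z \<in> ball 0 1"
    have "norm (z * G z) \<le> 1" using schur_class_times[OF G(2), of z z] z by simp
    hence d: "1 + cnj a * (z * G z) \<noteq> 0" by (rule disk_aut_denominator[OF a])
    have "F z * (1 + cnj a * (z * G z)) = z * G z + a"
      using F[of z] z d by (simp add: disk_aut_def)
    hence "F z * (1 + cnj a * (z * G z)) * poly q z = (z * G z + a) * poly q z" by simp
    hence "F z * (poly q z + cnj a * (z * (G z * poly q z))) = z * (G z * poly q z) + a * poly q z"
      by (simp only: ring_distribs mult_ac mult_1_left)
    thus "F z * poly ?q z = poly ?p z"
      using Gz[of z] z by (simp add: algebra_simps)
  qed
  thus ?thesis by (rule reflected_quotient_is_Blaschke)
qed

text \<open>
  Passing from \<open>F\<close> to \<open>G\<close> turns the pair \<open>p\<close>, \<open>q\<close> into \<open>p - a * q\<close>, \<open>q - cnj a * p\<close>. The first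
  of these vanishes at the origin, so it is the variable times a polynomial, and reflecting that
  polynomial needs one degree less.
\<close>

lemma reflected_step_down:
  assumes r: "reflected_pair (Suc n) p q" and p0: "p \<noteq> 0"
    and FQ: "\<And>z. norm z < 1 \<Longrightarrow> F z * poly q z = poly p z"
    and a: "norm a < 1" and G: "G \<in> schur_class"
    and F: "\<And>z. norm z < 1 \<Longrightarrow> F z = disk_aut a (z * G z)"
  shows "\<exists>p' q'. reflected_pair n p' q' \<and> p' \<noteq> 0 \<and>
    (\<forall>z. norm z < 1 \<longrightarrow> G z * poly q' z = poly p' z)"
proof -
  define R where "R = p - smult a q"
  define q' where "q' = q - smult (cnj a) p"
  have rR: "reflected_pair (Suc n) R q'"
    using reflected_pair_combine[OF r, of "-a"] by (simp add: R_def q'_def)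
  have "F 0 = a" using F[of 0] by (simp add: disk_aut_def)
  hence "poly R 0 = 0" using FQ[of 0] by (simp add: R_def)
  then obtain p' where p': "R = pCons 0 p'"
    by (cases R) (simp add: poly_0_coeff_0)
  have "R \<noteq> 0"
  proof
    assume "R = 0"
    hence "q' = 0" using rR by (intro poly_eqI) (auto simp: reflected_pairD(1)[OF rR])
    have "p = smult a q" "q = smult (cnj a) p"
      using \<open>R = 0\<close> \<open>q' = 0\<close> by (auto simp: R_def q'_def)
    hence "p = smult (a * cnj a) p" by (metis smult_smult)
    hence "smult (1 - a * cnj a) p = 0" by (simp add: smult_diff_left)
    moreover have "1 - a * cnj a \<noteq> 0" using disk_aut_denominator[of "-a" a] a by (simp add: mult.commute)
    ultimately show False using p0 by simp
  qed
  hence "p' \<noteq> 0" using p' by auto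
  (* The common factor z can be cancelled only away from the origin; continuity covers z = 0. *)
  have zG: "z * (G z * poly q' z - poly p' z) = 0" if z: "norm z < 1" for z
  proof -
    have "norm (z * G z) \<le> 1" using schur_class_times[OF G, of z z] z by simp
    hence d: "1 + cnj a * (z * G z) \<noteq> 0" by (rule disk_aut_denominator[OF a])
    have "F z * (1 + cnj a * (z * G z)) = z * G z + a"
      using F[OF z] d by (simp add: disk_aut_def)
    moreover have "F z * poly q z * (1 + cnj a * (z * G z)) = F z * (1 + cnj a * (z * G z)) * poly q z"
      by (simp only: mult_ac)
    ultimately have "poly p z * (1 + cnj a * (z * G z)) = (z * G z + a) * poly q z"
      by (simp only: FQ[OF z])
    hence "z * G z * poly q' z = poly R z" by (simp add: R_def q'_def algebra_simps)
    thus ?thesis by (simp add: p' algebra_simps)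
  qed
  have "G z * poly q' z = poly p' z" if z: "norm z < 1" for z
  proof (cases "z = 0")
    case True
    have "isCont G 0" using G
      by (intro continuous_on_interior[of "ball 0 1"]) (auto simp: schur_class_def holomorphic_on_imp_continuous_on)
    hence "isCont (\<lambda>z. G z * poly q' z - poly p' z) 0" by (intro continuous_intros)
    hence "((\<lambda>z. G z * poly q' z - poly p' z) \<longlongrightarrow> G 0 * poly q' 0 - poly p' 0) (at 0)"
      by (simp add: isCont_def)
    moreover have "\<forall>\<^sub>F z in at (0::complex). 0 = G z * poly q' z - poly p' z"
      unfolding eventually_at using zG by (intro exI[of _ 1]) (auto simp: dist_norm)
    ultimately have "G 0 * poly q' 0 - poly p' 0 = 0"
      by (metis Lim_transform_eventually[OF tendsto_const] tendsto_unique trivial_limit_at)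
    thus ?thesis using True by simp
  next
    case False
    thus ?thesis using zG[OF z] by simp
  qed
  moreover have "reflected_pair n p' q'" using rR reflected_pair_pCons unfolding p' by blast
  ultimately show ?thesis using \<open>p' \<noteq> 0\<close> by blast
qed

text \<open>
  A pair of formal degree \<open>n\<close> for the first function descends in \<open>n\<close> steps to a pair of constants
  of equal modulus, so that \<open>Fs n 0\<close> would have modulus 1.
\<close>

lemma schur_chain_not_Blaschke:
  assumes cls: "\<And>k. Fs k \<in> schur_class" and lt: "\<And>k. norm (Fs k 0) < 1"
    and step: "\<And>k z. norm z < 1 \<Longrightarrow> Fs k z = disk_aut (Fs k 0) (z * Fs (Suc k) z)"
  shows "\<not> finite_Blaschke_product (Fs 0)"
proof
  assume "finite_Blaschke_product (Fs 0)"
  then obtain n p q where "blaschke_pair (Fs 0) n p q" using Blaschke_imp_pair by blast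
  hence r: "reflected_pair n p q" "\<And>z. norm z < 1 \<Longrightarrow> Fs 0 z * poly q z = poly p z" "poly q 0 \<noteq> 0"
    by (auto simp: blaschke_pair_def)
  have "q = 0" if "p = 0" using that by (intro poly_eqI) (auto simp: reflected_pairD(1)[OF r(1)])
  hence "p \<noteq> 0" using r(3) by auto
  have False if "reflected_pair n p q" "p \<noteq> 0" "\<And>z. norm z < 1 \<Longrightarrow> Fs k z * poly q z = poly p z"
    for n p q k
    using that
  proof (induction n arbitrary: p q k)
    case 0
    obtain c where c: "p = [:c:]" using 0(1) degree_eq_zeroE[of p] by (auto simp: reflected_pair_def)
    have "coeff q 0 = cnj c" using 0(1) by (simp add: reflected_pair_def c)
    hence "Fs k 0 * cnj c = c" using 0(3)[of 0] by (simp add: poly_0_coeff_0 c)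
    hence "norm (Fs k 0) * norm c = norm c" by (metis complex_mod_cnj norm_mult)
    thus False using lt[of k] 0(2) by (simp add: c)
  next
    case (Suc n)
    show False
      using reflected_step_down[OF Suc.prems lt cls step] Suc.IH by blast
  qed
  thus False using r \<open>p \<noteq> 0\<close> by blast
qed

lemma schur_chain_limit:
  assumes a: "\<And>k. norm (a k) < 1"
  defines "Fs \<equiv> \<lambda>k. schur_limit (\<lambda>j. a (k + j))"
  shows "Fs k \<in> schur_class" "Fs k 0 = a k" "norm (Fs k 0) < 1"
    and "norm z < 1 \<Longrightarrow> Fs k z = disk_aut (Fs k 0) (z * Fs (Suc k) z)"
proof -
  show "Fs k \<in> schur_class" unfolding Fs_def by (rule schur_limit_schur_class) (rule a)
  have Fs0: "schur_limit (\<lambda>j. a (k + j)) 0 = a (k + 0)" by (rule schur_limit_0) (rule a)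
  thus 0: "Fs k 0 = a k" by (simp add: Fs_def)
  thus "norm (Fs k 0) < 1" using a by simp
  assume z: "norm z < 1"
  have "schur_limit (\<lambda>j. a (k + j)) z = disk_aut (a (k + 0)) (z * schur_limit (\<lambda>j. a (k + Suc j)) z)"
    by (rule schur_limit_rec) (rule a, rule z)
  thus "Fs k z = disk_aut (Fs k 0) (z * Fs (Suc k) z)"
    unfolding 0 by (simp only: Fs_def add_0_right add_Suc_right add_Suc)
qed

lemma schur_limit_schur_star:
  assumes a: "\<And>k. norm (a k) < 1"
  shows "schur_limit a \<in> schur_star_disk"
proof -
  note ch = schur_chain_limit[of a, OF a]
  have "\<not> finite_Blaschke_product (schur_limit (\<lambda>j. a (0 + j)))"
    by (rule schur_chain_not_Blaschke[where Fs = "\<lambda>k. schur_limit (\<lambda>j. a (k + j))", OF ch(1,3,4)])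
  thus ?thesis using ch(1)[of 0] by (simp add: schur_star_disk_def schur_class_def)
qed

text \<open>
  Not being a finite Blaschke product is inherited by the quotient, so the algorithm of Schur never
  stops.
\<close>

lemma schur_star_chain:
  assumes F: "F \<in> schur_star_disk"
  defines "Fs \<equiv> \<lambda>k. (schur_step ^^ k) F"
  shows "Fs k \<in> schur_class" "norm (Fs k 0) < 1"
    and "norm z < 1 \<Longrightarrow> Fs k z = disk_aut (Fs k 0) (z * Fs (Suc k) z)"
proof -
  have Suc: "Fs (Suc k) = schur_step (Fs k)" for k by (simp add: Fs_def)
  have star: "Fs k \<in> schur_class \<and> \<not> finite_Blaschke_product (Fs k)" for k
  proof (induction k)
    case 0
    show ?case using F by (simp add: Fs_def schur_star_disk_def schur_class_def)
  next
    case (Suc k)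
    have lt: "norm (Fs k z) < 1" if "norm z < 1" for z
      using schur_class_norm_less Suc.IH that by blast
    have cls: "schur_step (Fs k) \<in> schur_class"
      by (rule schur_step(1)) (use Suc.IH lt in blast)+
    moreover have "\<not> finite_Blaschke_product (schur_step (Fs k))"
    proof
      assume "finite_Blaschke_product (schur_step (Fs k))"
      hence "finite_Blaschke_product (Fs k)"
      proof (rule Blaschke_step_up[OF _ cls])
        show "norm (Fs k 0) < 1" by (rule lt) simp
        show "Fs k z = disk_aut (Fs k 0) (z * schur_step (Fs k) z)" if "norm z < 1" for z
          by (rule schur_step(2)) (use Suc.IH lt that in blast)+
      qed
      thus False using Suc.IH by blast
    qed
    ultimately show ?case unfolding \<open>\<And>k. Fs (Suc k) = schur_step (Fs k)\<close> by blast
  qed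
  have lt: "norm (Fs k z) < 1" if "norm z < 1" for z k
    using schur_class_norm_less star that by blast
  show "Fs k \<in> schur_class" using star by blast
  show "norm (Fs k 0) < 1" by (rule lt) simp
  show "Fs k z = disk_aut (Fs k 0) (z * Fs (Suc k) z)" if "norm z < 1"
    unfolding Suc by (rule schur_step(2)) (use star lt that in blast)+
qed

section \<open>Integration against point masses\<close>

definition real_point_mass_sum :: "real \<Rightarrow> (nat \<Rightarrow> real) \<Rightarrow> real set \<Rightarrow> real" where
  "real_point_mass_sum ell r A = (if A \<in> bounded_borel then \<Sum>k | ell * real k \<in> A. r k else 0)"

text \<open>
  Negative weights are replaced by 0, so that this is the positive variation of the signed measure
  with the weights \<open>r\<close>.
\<close>

definition atomic_measure :: "real \<Rightarrow> (nat \<Rightarrow> real) \<Rightarrow> real measure" where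
  "atomic_measure ell r = distr (density (count_space UNIV) (\<lambda>k. ennreal (max 0 (r k)))) borel (\<lambda>k. ell * real k)"

lemma emeasure_atomic_measure:
  assumes "A \<in> sets borel"
  shows "emeasure (atomic_measure ell r) A = (\<Sum>k. ennreal (max 0 (r k)) * indicator A (ell * real k))"
proof -
  have "emeasure (atomic_measure ell r) A
      = (\<integral>\<^sup>+k. ennreal (max 0 (r k)) * indicator {k. ell * real k \<in> A} k \<partial>count_space UNIV)"
    using assms by (simp add: atomic_measure_def emeasure_distr emeasure_density vimage_def)
  thus ?thesis by (simp add: nn_integral_count_space_nat indicator_def)
qed

text \<open>
  The supremum over bounded Borel subsets is approached along the finite sets of those lattice
  points in \<open>A\<close> that carry a positive weight.
\<close>

lemma pos_variation_point_masses:
  assumes ell: "ell > 0"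
  shows "pos_variation (real_point_mass_sum ell r) = atomic_measure ell r"
proof -
  let ?M = "atomic_measure ell r"
  let ?p = "\<lambda>k. ennreal (max 0 (r k))"
  have eq: "(SUP B\<in>{B \<in> bounded_borel. B \<subseteq> A}. ennreal (real_point_mass_sum ell r B)) = emeasure ?M A"
    if A: "A \<in> sets borel" for A
  proof (rule antisym)
    show "(SUP B\<in>{B \<in> bounded_borel. B \<subseteq> A}. ennreal (real_point_mass_sum ell r B)) \<le> emeasure ?M A"
    proof (rule SUP_least)
      fix B assume B: "B \<in> {B \<in> bounded_borel. B \<subseteq> A}"
      let ?K = "{k. ell * real k \<in> B}"
      have fin: "finite ?K" using finite_lattice_points[OF ell] B by blast
      have "ennreal (real_point_mass_sum ell r B) = ennreal (\<Sum>k\<in>?K. r k)"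
        using B by (simp add: real_point_mass_sum_def)
      also have "\<dots> \<le> ennreal (\<Sum>k\<in>?K. max 0 (r k))"
        by (intro ennreal_leI sum_mono) simp
      also have "\<dots> = (\<Sum>k\<in>?K. ?p k)" by (simp add: sum_ennreal)
      also have "\<dots> = (\<Sum>k\<in>?K. ?p k * indicator A (ell * real k))"
        using B by (intro sum.cong) (auto simp: indicator_def)
      also have "\<dots> \<le> (\<Sum>k. ?p k * indicator A (ell * real k))"
        by (rule sum_le_suminf) (use fin in auto)
      finally show "ennreal (real_point_mass_sum ell r B) \<le> emeasure ?M A"
        by (simp add: emeasure_atomic_measure[OF A])
    qed
    show "emeasure ?M A \<le> (SUP B\<in>{B \<in> bounded_borel. B \<subseteq> A}. ennreal (real_point_mass_sum ell r B))"
      unfolding emeasure_atomic_measure[OF A] suminf_eq_SUP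
    proof (rule SUP_least)
      fix n
      let ?K = "{k. k < n \<and> ell * real k \<in> A \<and> r k > 0}"
      let ?B = "(\<lambda>k. ell * real k) ` ?K"
      have B: "?B \<in> {B \<in> bounded_borel. B \<subseteq> A}"
        by (auto intro!: finite_imp_bounded borel_closed finite_imp_closed)
      have K: "{k. ell * real k \<in> ?B} = ?K" using ell by auto
      have "(\<Sum>k<n. ?p k * indicator A (ell * real k)) = (\<Sum>k\<in>?K. ?p k)"
        by (intro sum.mono_neutral_cong_right) (auto simp: indicator_def not_less ennreal_neg)
      also have "\<dots> = (\<Sum>k\<in>?K. ennreal (r k))" by (intro sum.cong) auto
      also have "\<dots> = ennreal (\<Sum>k\<in>?K. r k)" by (rule sum_ennreal) auto
      also have "\<dots> = ennreal (real_point_mass_sum ell r ?B)"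
        using B K by (simp add: real_point_mass_sum_def)
      also have "\<dots> \<le> (SUP B\<in>{B \<in> bounded_borel. B \<subseteq> A}. ennreal (real_point_mass_sum ell r B))"
        using B by (rule SUP_upper)
      finally show "(\<Sum>k<n. ?p k * indicator A (ell * real k))
         \<le> (SUP B\<in>{B \<in> bounded_borel. B \<subseteq> A}. ennreal (real_point_mass_sum ell r B))" .
    qed
  qed
  have "pos_variation (real_point_mass_sum ell r) = measure_of UNIV (sets borel) (emeasure ?M)"
    unfolding pos_variation_def
  proof (rule measure_of_eq)
    show "(SUP B\<in>{B \<in> bounded_borel. B \<subseteq> A}. ennreal (real_point_mass_sum ell r B)) = emeasure ?M A"
      if "A \<in> sigma_sets UNIV (sets borel)" for A
      using that eq sets.sigma_sets_eq[of "borel :: real measure"] by simp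
  qed simp
  also have "\<dots> = ?M" using measure_of_of_measure[of ?M] by (simp add: atomic_measure_def)
  finally show ?thesis .
qed

lemma integral_atomic_measure:
  fixes f :: "real \<Rightarrow> complex"
  assumes f: "f \<in> borel_measurable borel" and S: "S \<in> sets borel" and fin: "finite {k. ell * real k \<in> S}"
  shows "(LINT t:S|atomic_measure ell r. f t) = (\<Sum>k | ell * real k \<in> S. of_real (max 0 (r k)) * f (ell * real k))"
proof -
  let ?g = "\<lambda>k. max 0 (r k) *\<^sub>R (indicat_real S (ell * real k) *\<^sub>R f (ell * real k))"
  have m: "(\<lambda>t. indicat_real S t *\<^sub>R f t) \<in> borel_measurable borel"
    using f S by measurable
  have "(LINT t:S|atomic_measure ell r. f t) = (\<integral>k. ?g k \<partial>count_space UNIV)"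
    unfolding set_lebesgue_integral_def atomic_measure_def
    by (subst integral_distr[OF _ m], simp, subst integral_density) auto
  also have "\<dots> = (\<Sum>k | k \<in> UNIV \<and> ?g k \<noteq> 0. ?g k)"
    by (rule lebesgue_integral_count_space_finite_support)
       (rule finite_subset[OF _ fin], auto simp: indicator_def split: if_splits)
  also have "\<dots> = (\<Sum>k | ell * real k \<in> S. of_real (max 0 (r k)) * f (ell * real k))"
    by (rule sum.mono_neutral_cong_left[OF fin]) (auto simp: indicator_def scaleR_conv_of_real split: if_splits)
  finally show ?thesis .
qed

lemma signed_integral_point_masses:
  fixes f :: "real \<Rightarrow> complex"
  assumes ell: "ell > 0" and f: "f \<in> borel_measurable borel"
    and S: "S \<in> sets borel" and fin: "finite {k. ell * real k \<in> S}"
  shows "signed_integral (real_point_mass_sum ell r) S f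
    = (\<Sum>k | ell * real k \<in> S. of_real (r k) * f (ell * real k))"
proof -
  have neg: "(\<lambda>A. - real_point_mass_sum ell r A) = real_point_mass_sum ell (\<lambda>k. - r k)"
    by (auto simp: fun_eq_iff real_point_mass_sum_def sum_negf)
  have "complex_of_real (max 0 (r k)) * w - of_real (max 0 (- r k)) * w = of_real (r k) * w" for k w
    by (cases "r k \<ge> 0") (auto simp: max_def)
  thus ?thesis
    unfolding signed_integral_def neg pos_variation_point_masses[OF ell]
      integral_atomic_measure[OF f S fin]
    by (simp add: sum_subtractf[symmetric])
qed

text \<open>
  Each entry of the potential is a real signed measure, and only positive and negative variations
  of real point masses have to be computed.
\<close>

lemma potential_component_cases:
  fixes j k :: 2
  obtains "\<And>q A. potential q A $ j $ k = of_real (Im (q A))"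
  | "\<And>q A. potential q A $ j $ k = of_real (Re (q A))"
  | "\<And>q A. potential q A $ j $ k = of_real (- Im (q A))"
  using exhaust_2[of j] exhaust_2[of k] by (auto simp: potential_def)

lemma complex_integral_point_masses:
  fixes f :: "real \<Rightarrow> complex" and c :: "nat \<Rightarrow> complex" and j k :: 2
  assumes ell: "ell > 0" and f: "f \<in> borel_measurable borel"
    and S: "S \<in> sets borel" and fin: "finite {n. ell * real n \<in> S}"
  defines "q \<equiv> point_mass_sum ell c"
  shows "complex_integral (\<lambda>A. potential q A $ j $ k) S f
    = (\<Sum>n | ell * real n \<in> S. potential q {ell * real n} $ j $ k * f (ell * real n))"
proof -
  define r where "r = (\<lambda>n. Re (potential q {ell * real n} $ j $ k))"
  have qn: "q {ell * real n} = c n" for n unfolding q_def by (rule point_mass_sum_singleton[OF ell])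
  have q: "Re (q A) = real_point_mass_sum ell (\<lambda>n. Re (c n)) A"
    "Im (q A) = real_point_mass_sum ell (\<lambda>n. Im (c n)) A"
    "- Im (q A) = real_point_mass_sum ell (\<lambda>n. - Im (c n)) A" for A
    by (auto simp: q_def point_mass_sum_def real_point_mass_sum_def sum_negf)
  have re: "(\<lambda>A. Re (potential q A $ j $ k)) = real_point_mass_sum ell r"
    by (rule potential_component_cases[of j k]; simp add: r_def qn; rule ext; rule q)
  have im: "(\<lambda>A. Im (potential q A $ j $ k)) = real_point_mass_sum ell (\<lambda>_. 0)"
    by (rule potential_component_cases[of j k]) (simp_all add: real_point_mass_sum_def fun_eq_iff)
  have "potential q {ell * real n} $ j $ k = of_real (r n)" for n
    by (rule potential_component_cases[of j k]) (auto simp: r_def)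
  thus ?thesis
    unfolding complex_integral_def re im signed_integral_point_masses[OF ell f S fin] by simp
qed

section \<open>Matrices of the Dirac system\<close>

lemmas mat2_simps = vec_eq_iff forall_2 sum_2 matrix_matrix_mult_def mat_def transpose_def

definition potential_matrix :: "complex \<Rightarrow> complex^2^2" where
  "potential_matrix c = vector [vector [of_real (Im c), of_real (Re c)],
                                vector [of_real (Re c), - of_real (Im c)]]"

lemma potential_eq: "potential q A = potential_matrix (q A)"
  by (simp add: potential_def potential_matrix_def)

text \<open>
  The powers of this matrix in the series \<open>gmat\<close> collapse, since its square is a multiple of the
  identity.
\<close>

definition generator :: "complex \<Rightarrow> complex^2^2" where
  "generator c = potential_matrix c ** transpose J"

lemma generator_entries [simp]:
  "generator c $ 1 $ 1 = - of_real (Re c)" "generator c $ 1 $ 2 = of_real (Im c)"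
  "generator c $ 2 $ 1 = of_real (Im c)" "generator c $ 2 $ 2 = of_real (Re c)"
  by (simp_all add: generator_def mat2_simps J_def potential_matrix_def)

lemma J_entries [simp]: "J $ 1 $ 1 = 0" "J $ 1 $ 2 = -1" "J $ 2 $ 1 = 1" "J $ 2 $ 2 = 0"
  by (simp_all add: J_def)

text \<open>
  This is the matrix exponential of \<open>generator c\<close>, in closed form.
\<close>

definition kick :: "complex \<Rightarrow> complex^2^2" where
  "kick c = cosh (norm c) *\<^sub>R mat 1 + (sinh (norm c) / norm c) *\<^sub>R generator c"

definition rotation :: "complex \<Rightarrow> complex^2^2" where
  "rotation \<theta> = vector [vector [cos \<theta>, sin \<theta>], vector [- sin \<theta>, cos \<theta>]]"

lemma scaleR_complex: "x *\<^sub>R (w::complex) = of_real x * w"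
  by (rule scaleR_conv_of_real)

lemma generator_square: "generator c ** generator c = (norm c)\<^sup>2 *\<^sub>R mat 1"
proof -
  have "complex_of_real (norm c) * of_real (norm c) = of_real (Im c * Im c + Re c * Re c)"
    unfolding of_real_mult[symmetric] using cmod_power2[of c] by (simp add: power2_eq_square add.commute)
  thus ?thesis by (simp add: mat2_simps scaleR_complex power2_eq_square add.commute)
qed

lemma potential_matrix_eq: "potential_matrix c = generator c ** J"
  by (simp add: mat2_simps potential_matrix_def)

lemma matrix_mult_add_left: "(A + B) ** M = A ** M + B ** (M :: complex^2^2)"
  by (simp add: mat2_simps algebra_simps)

lemma matrix_mult_scaleR: "A ** (x *\<^sub>R B) = x *\<^sub>R (A ** B :: complex^2^2)"
  "(x *\<^sub>R A) ** B = x *\<^sub>R (A ** B)" for A B :: "complex^2^2"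
  by (simp_all add: mat2_simps scaleR_complex algebra_simps)

lemma generator_power:
  "(((**) (generator c)) ^^ n) (mat 1)
     = (if even n then norm c ^ n *\<^sub>R mat 1 else norm c ^ (n - 1) *\<^sub>R generator c)"
proof (induction n)
  case (Suc n)
  show ?case
  proof (cases "even n")
    case True
    thus ?thesis using Suc by (simp add: matrix_mult_scaleR)
  next
    case False
    then obtain m where "n = Suc m" by (cases n) auto
    thus ?thesis using False Suc
      by (simp add: matrix_mult_scaleR generator_square power2_eq_square mult.commute mult.left_commute)
  qed
qed simp

lemma gmat_0: "gmat (generator 0) = mat 1"
proof -
  have z: "generator 0 = 0" by (simp add: mat2_simps)
  have "(((**) (generator 0)) ^^ (n + 1)) (mat 1) = 0" for n
    by (simp add: z mat2_simps)
  thus ?thesis by (simp add: gmat_def)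
qed

lemma gmat_generator:
  assumes "c \<noteq> 0"
  shows "gmat (generator c) = (sinh (norm c) / norm c) *\<^sub>R mat 1
     + ((cosh (norm c) - 1) / (norm c)\<^sup>2) *\<^sub>R generator c"
proof -
  let ?r = "norm c"
  have r: "?r \<noteq> 0" using assms by simp
  have "(\<lambda>n. if even (n + 2) then 0 else ?r ^ (n + 2) /\<^sub>R fact (n + 2)) sums (sinh ?r - ?r)"
    using sums_split_initial_segment[OF sinh_converges[of ?r], of 2] by (simp add: eval_nat_numeral)
  from sums_divide[OF this, of ?r]
  have "(\<lambda>n. (if even (n + 2) then 0 else ?r ^ (n + 2) /\<^sub>R fact (n + 2)) / ?r) sums (sinh ?r / ?r - 1)"
    using r by (simp only: diff_divide_distrib divide_self_if if_False)
  moreover have "(if even (n + 2) then 0 else ?r ^ (n + 2) /\<^sub>R fact (n + 2)) / ?r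
      = (if even n then 0 else ?r ^ (n + 1) / fact (n + 2))" for n
    using r by (simp add: divide_inverse mult.commute)
  ultimately have s: "(\<lambda>n. if even n then 0 else ?r ^ (n + 1) / fact (n + 2)) sums (sinh ?r / ?r - 1)"
    by (simp only:)
  have "(\<lambda>n. if even (n + 2) then ?r ^ (n + 2) /\<^sub>R fact (n + 2) else 0) sums (cosh ?r - 1)"
    using sums_split_initial_segment[OF cosh_converges[of ?r], of 2] by (simp add: eval_nat_numeral)
  from sums_divide[OF this, of "?r\<^sup>2"]
  have "(\<lambda>n. (if even (n + 2) then ?r ^ (n + 2) /\<^sub>R fact (n + 2) else 0) / ?r\<^sup>2)
      sums ((cosh ?r - 1) / ?r\<^sup>2)" .
  moreover have "(if even (n + 2) then ?r ^ (n + 2) /\<^sub>R fact (n + 2) else 0) / ?r\<^sup>2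
      = (if even n then ?r ^ n / fact (n + 2) else 0)" for n
    using r by (simp add: power_add power2_eq_square divide_simps)
  ultimately have c: "(\<lambda>n. if even n then ?r ^ n / fact (n + 2) else 0) sums ((cosh ?r - 1) / ?r\<^sup>2)"
    by (simp only:)
  have "(1 / fact (n + 2)) *\<^sub>R (((**) (generator c)) ^^ (n + 1)) (mat 1)
      = (if even n then 0 else ?r ^ (n + 1) / fact (n + 2)) *\<^sub>R mat 1
      + (if even n then ?r ^ n / fact (n + 2) else 0) *\<^sub>R generator c" for n
    unfolding generator_power by simp
  moreover have "(\<lambda>n. (if even n then 0 else ?r ^ (n + 1) / fact (n + 2)) *\<^sub>R mat 1
      + (if even n then ?r ^ n / fact (n + 2) else 0) *\<^sub>R generator c)
      sums ((sinh ?r / ?r - 1) *\<^sub>R mat 1 + ((cosh ?r - 1) / ?r\<^sup>2) *\<^sub>R generator c)"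
    by (intro sums_add sums_scaleR_left s c)
  ultimately have "(\<Sum>n. (1 / fact (n + 2)) *\<^sub>R (((**) (generator c)) ^^ (n + 1)) (mat 1))
     = (sinh ?r / ?r - 1) *\<^sub>R mat 1 + ((cosh ?r - 1) / ?r\<^sup>2) *\<^sub>R generator c"
    by (simp only: sums_unique[symmetric])
  thus ?thesis by (simp add: gmat_def scaleR_diff_left)
qed

text \<open>
  The series \<open>gmat T\<close> is \<open>(exp T - 1) / T\<close>, and the potential is the generator times \<open>J\<close>.
\<close>

lemma gmat_jump:
  "gmat (generator c) ** potential_matrix c = (kick c - mat 1) ** J"
proof (cases "c = 0")
  case True
  thus ?thesis by (simp add: kick_def gmat_0 mat2_simps potential_matrix_def)
next
  case False
  let ?r = "norm c"
  have r: "?r \<noteq> 0" using False by simp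
  have "gmat (generator c) ** generator c = kick c - mat 1"
    unfolding gmat_generator[OF False] kick_def matrix_mult_add_left matrix_mult_scaleR generator_square
    using r by (simp add: scaleR_diff_left)
  thus ?thesis unfolding potential_matrix_eq matrix_mul_assoc by simp
qed

lemma kick_entries:
  fixes c defines "C \<equiv> cosh (norm c)" and "S \<equiv> sinh (norm c) / norm c"
  shows "kick c $ 1 $ 1 = of_real (C - S * Re c)" "kick c $ 1 $ 2 = of_real (S * Im c)"
    "kick c $ 2 $ 1 = of_real (S * Im c)" "kick c $ 2 $ 2 = of_real (C + S * Re c)"
  by (simp_all add: kick_def C_def S_def mat_def scaleR_complex)

lemma kick_determinant:
  "(cosh (norm c))\<^sup>2 - (sinh (norm c) / norm c)\<^sup>2 * ((Re c)\<^sup>2 + (Im c)\<^sup>2) = 1"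
proof (cases "c = 0")
  case False
  have "(sinh (norm c) / norm c)\<^sup>2 * ((Re c)\<^sup>2 + (Im c)\<^sup>2) = (sinh (norm c))\<^sup>2"
    using False by (simp add: cmod_power2[symmetric] power_divide)
  thus ?thesis using cosh_square_eq[of "norm c"] by simp
qed simp

text \<open>
  The exponential of a traceless matrix has determinant 1, and a symmetric matrix of determinant 1
  preserves \<open>J\<close>.
\<close>

lemma kick_J_kick: "kick c ** J ** kick c = J"
proof -
  define C where "C = cosh (norm c)"
  define S where "S = sinh (norm c) / norm c"
  have "C\<^sup>2 - S\<^sup>2 * ((Re c)\<^sup>2 + (Im c)\<^sup>2) = 1" unfolding C_def S_def by (rule kick_determinant)
  hence "C * C = 1 + S * S * (Re c * Re c + Im c * Im c)" by (simp add: power2_eq_square)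
  hence "complex_of_real (C * C) = of_real (1 + S * S * (Re c * Re c + Im c * Im c))" by simp
  hence d: "complex_of_real C * of_real C
      = 1 + of_real S * of_real S * (of_real (Re c) * of_real (Re c) + of_real (Im c) * of_real (Im c))"
    by simp
  show ?thesis
    by (simp add: mat2_simps kick_entries C_def[symmetric] S_def[symmetric] algebra_simps d)
qed

text \<open>
  The left-hand side is the jump relation of the Dirac system at a lattice point: \<open>M\<close> is the value
  there and \<open>M'\<close> the left limit.
\<close>

lemma kick_equation:
  "kick c ** J ** M = J ** M' \<longleftrightarrow> M = kick c ** M'"
proof
  assume *: "kick c ** J ** M = J ** M'"
  have JJ: "J ** J = - mat 1" by (simp add: mat2_simps)
  have "kick c ** J ** (kick c ** J ** M) = J ** J ** M"
    by (simp only: matrix_mul_assoc kick_J_kick)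
  also have "\<dots> = - M" by (simp add: JJ mat2_simps)
  finally have "kick c ** J ** (J ** M') = - M" unfolding * .
  moreover have "kick c ** J ** (J ** M') = kick c ** (J ** J) ** M'"
    by (simp only: matrix_mul_assoc)
  moreover have "kick c ** (J ** J) ** M' = - (kick c ** M')"
    by (simp add: JJ mat2_simps algebra_simps)
  ultimately show "M = kick c ** M'" by simp
next
  assume "M = kick c ** M'"
  thus "kick c ** J ** M = J ** M'" by (simp add: matrix_mul_assoc kick_J_kick)
qed

lemma J_cancel: "J ** A = J ** B \<longleftrightarrow> A = (B :: complex^2^2)"
proof
  assume "J ** A = J ** B"
  hence "J ** (J ** A) = J ** (J ** B)" by simp
  moreover have "J ** (J ** M) = - M" for M :: "complex^2^2" by (simp add: mat2_simps)
  ultimately show "A = B" by simp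
qed simp

section \<open>The flow between the point masses\<close>

lemma has_vector_derivative_exp_linear:
  "((\<lambda>y. exp (k * complex_of_real (y - a))) has_vector_derivative k * exp (k * of_real (y - a))) (at y within S)"
proof -
  have "((\<lambda>w. exp (k * (w - of_real a))) has_field_derivative exp (k * (of_real y - of_real a)) * k)
      (at (complex_of_real y))"
    by (auto intro!: derivative_eq_intros)
  from has_vector_derivative_real_field[OF this, of S] show ?thesis by (simp add: mult.commute)
qed

text \<open>
  The integral equation makes \<open>u\<close> continuous and then differentiable; its product with
  \<open>exp (- k * (x - a))\<close> has derivative 0.
\<close>

lemma scalar_flow_closed:
  fixes u :: "real \<Rightarrow> complex"
  assumes int: "u integrable_on {a..b}"
    and eq: "\<And>x. x \<in> {a..b} \<Longrightarrow> u x = u0 + k * integral {a..x} u" and x: "x \<in> {a..b}"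
  shows "u x = u0 * exp (k * of_real (x - a))"
proof -
  have "continuous_on {a..b} (\<lambda>x. u0 + k * integral {a..x} u)"
    by (intro continuous_intros indefinite_integral_continuous_1 int)
  hence cont: "continuous_on {a..b} u"
    by (rule continuous_on_eq) (simp add: eq)
  have du: "(u has_vector_derivative k * u y) (at y within {a..b})" if y: "y \<in> {a..b}" for y
  proof -
    have "((\<lambda>x. u0 + k * integral {a..x} u) has_vector_derivative 0 + k * u y) (at y within {a..b})"
      by (intro has_vector_derivative_add has_vector_derivative_const
          bounded_linear.has_vector_derivative[OF bounded_linear_mult_right]
          integral_has_vector_derivative cont y)
    hence "((\<lambda>x. u0 + k * integral {a..x} u) has_vector_derivative k * u y) (at y within {a..b})" by simp
    thus ?thesis by (rule has_vector_derivative_transform[rotated 2]) (use eq y in auto)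
  qed
  define e where "e = (\<lambda>y::real. exp (- k * of_real (y - a)))"
  have de: "(e has_vector_derivative - k * e y) (at y within {a..b})" for y
    unfolding e_def by (rule has_vector_derivative_exp_linear)
  have "((\<lambda>y. u y * e y) has_vector_derivative 0) (at y within {a..b})" if "y \<in> {a..b}" for y
    using has_vector_derivative_mult[OF du[OF that] de[of y]] by (simp add: algebra_simps)
  then obtain c where c: "\<And>y. y \<in> {a..b} \<Longrightarrow> u y * e y = c"
    using has_vector_derivative_zero_constant[of "{a..b}" "\<lambda>y. u y * e y"] by (metis convex_real_interval(5))
  have "u a = u0" using eq[of a] x by simp
  hence "c = u0" using c[of a] x by (simp add: e_def)
  hence "u x * e x * exp (k * of_real (x - a)) = u0 * exp (k * of_real (x - a))" using c x by simp
  moreover have "e x * exp (k * of_real (x - a)) = 1" by (simp add: e_def flip: exp_add)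
  ultimately show ?thesis by (simp only: mult.assoc mult_1_right)
qed

lemma integral_spike_right_end:
  fixes u v :: "real \<Rightarrow> complex"
  assumes "\<And>x. x \<in> {a..<b} \<Longrightarrow> u x = v x" "x \<in> {a..b}"
  shows "integral {a..x} u = integral {a..x} v"
  by (rule integral_spike[of "{b}"]) (use assms in auto)

text \<open>
  The value of \<open>u\<close> at the right end of the interval is arbitrary, as a new jump occurs there. The
  right-hand side of the equation is a continuous modification of \<open>u\<close> that solves the equation on
  the closed interval.
\<close>

lemma scalar_flow:
  fixes u :: "real \<Rightarrow> complex"
  assumes int: "u integrable_on {a..b}" and eq: "\<And>x. x \<in> {a..<b} \<Longrightarrow> u x = u a + k * integral {a..x} u"
    and x: "x \<in> {a..<b}"
  shows "u x = u a * exp (k * of_real (x - a))"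
proof -
  define v where "v = (\<lambda>x. u a + k * integral {a..x} u)"
  have uv: "u x = v x" if "x \<in> {a..<b}" for x unfolding v_def using that by (rule eq)
  have "continuous_on {a..b} v" unfolding v_def
    by (intro continuous_intros indefinite_integral_continuous_1 int)
  hence "v integrable_on {a..b}" by (rule integrable_continuous_real)
  hence "v x = u a * exp (k * of_real (x - a))"
  proof (rule scalar_flow_closed)
    fix x assume x: "x \<in> {a..b}"
    have "v x = u a + k * integral {a..x} u" by (simp only: v_def)
    also have "integral {a..x} u = integral {a..x} v"
      using uv x by (rule integral_spike_right_end)
    finally show "v x = u a + k * integral {a..x} v" .
  qed (use x in auto)
  thus ?thesis using uv[OF x] by simp
qed

lemma scalar_flow_integral:
  fixes u :: "real \<Rightarrow> complex"
  assumes eq: "\<And>x. x \<in> {a..<b} \<Longrightarrow> u x = u a * exp (k * of_real (x - a))"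
    and x: "x \<in> {a..b}"
  shows "u a * exp (k * of_real (x - a)) = u a + k * integral {a..x} u"
proof -
  define v where "v = (\<lambda>x. u a * exp (k * complex_of_real (x - a)))"
  have dv: "(v has_vector_derivative k * v y) (at y within {a..x})" for y
    using bounded_linear.has_vector_derivative[OF bounded_linear_mult_right[of "u a"] has_vector_derivative_exp_linear]
    by (simp add: v_def mult.left_commute)
  have "((\<lambda>y. k * v y) has_integral v x - v a) {a..x}"
    by (rule fundamental_theorem_of_calculus) (use dv x in auto)
  hence "integral {a..x} (\<lambda>y. k * v y) = v x - v a" by (rule integral_unique)
  moreover have "v a = u a" by (simp add: v_def)
  ultimately have "k * integral {a..x} v = v x - u a" by simp
  moreover have "integral {a..x} u = integral {a..x} v"
  proof (rule integral_spike_right_end[OF _ x])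
    show "u y = v y" if "y \<in> {a..<b}" for y unfolding v_def using that by (rule eq)
  qed
  ultimately show ?thesis by (simp add: v_def)
qed

text \<open>
  For \<open>s = \<i>\<close> and \<open>s = - \<i>\<close> these are the linear combinations of the entries of a column that
  diagonalise the rotations.
\<close>

definition mode :: "complex \<Rightarrow> 2 \<Rightarrow> complex^2^2 \<Rightarrow> complex" where
  "mode s l M = M $ 1 $ l + s * M $ 2 $ l"

lemma matrix_eq_iff_modes:
  "A = B \<longleftrightarrow> (\<forall>l. \<forall>s\<in>{\<i>, -\<i>}. mode s l A = mode s l B)"
proof
  assume *: "\<forall>l. \<forall>s\<in>{\<i>, -\<i>}. mode s l A = mode s l B"
  have "A $ 1 $ l = B $ 1 $ l \<and> A $ 2 $ l = B $ 2 $ l" for l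
  proof -
    have e: "A $ 1 $ l + \<i> * A $ 2 $ l = B $ 1 $ l + \<i> * B $ 2 $ l"
      "A $ 1 $ l - \<i> * A $ 2 $ l = B $ 1 $ l - \<i> * B $ 2 $ l"
      using * by (auto simp: mode_def)
    have "2 * A $ 1 $ l = 2 * B $ 1 $ l" using arg_cong2[OF e, of "(+)"] by simp
    thus ?thesis using e by simp
  qed
  thus "A = B" by (simp add: vec_eq_iff forall_2)
qed simp

lemma bounded_linear_mode: "bounded_linear (mode s l)"
  unfolding mode_def
  by (intro bounded_linear_add bounded_linear_compose[OF bounded_linear_mult_right]
      bounded_linear_compose[OF bounded_linear_vec_nth bounded_linear_vec_nth])

lemma mode_rotation:
  assumes "s \<in> {\<i>, -\<i>}"
  shows "mode s l (rotation \<theta> ** M) = exp (- s * \<theta>) * mode s l M"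
proof -
  have e: "exp (- s * \<theta>) = cos \<theta> - s * sin \<theta>" and "s * s = -1"
    using assms exp_Euler[of \<theta>] exp_Euler[of "-\<theta>"] by auto
  have "mode s l (rotation \<theta> ** M) - exp (- s * \<theta>) * mode s l M = (1 + s * s) * (sin \<theta> * M $ 2 $ l)"
    unfolding e by (simp add: mode_def rotation_def matrix_matrix_mult_def sum_2 algebra_simps)
  thus ?thesis using \<open>s * s = -1\<close> by simp
qed

text \<open>
  In the modes the equation \<open>J N' = z N\<close> splits into scalar equations.
\<close>

lemma J_equation_modes:
  "J ** M = J ** M0 + mat z ** K \<longleftrightarrow>
    (\<forall>l. \<forall>s\<in>{\<i>, -\<i>}. mode s l M = mode s l M0 + (- s * z) * mode s l K)"
proof -
  have "J ** M = J ** M0 + mat z ** K \<longleftrightarrow> M = M0 - J ** mat z ** K"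
    by (auto simp: mat2_simps algebra_simps)
  moreover have "mode s l (M0 - J ** mat z ** K) = mode s l M0 + (- s * z) * mode s l K"
    if "s \<in> {\<i>, -\<i>}" for s l
    using that by (auto simp: mode_def mat2_simps algebra_simps)
  ultimately show ?thesis unfolding matrix_eq_iff_modes[of M] by simp
qed

lemma mode_integral:
  assumes "N integrable_on S"
  shows "mode s l (integral S N) = integral S (\<lambda>t. mode s l (N t))"
  using integral_linear[OF assms bounded_linear_mode, of s l] by (simp add: o_def)

lemma flow_solution:
  fixes N :: "real \<Rightarrow> complex^2^2"
  assumes int: "N integrable_on {a..b}"
    and eq: "\<And>x. x \<in> {a..<b} \<Longrightarrow> J ** N x = J ** N a + mat z ** integral {a..x} N"
    and x: "x \<in> {a..<b}"
  shows "N x = rotation (z * of_real (x - a)) ** N a"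
  unfolding matrix_eq_iff_modes[of "N x"]
proof (intro allI ballI)
  fix l :: 2 and s assume s: "s \<in> {\<i>, -\<i>}"
  have sub: "N integrable_on {a..y}" if "y \<in> {a..<b}" for y
    using that by (intro integrable_on_subinterval[OF int]) auto
  have "mode s l (N x) = mode s l (N a) * exp ((- s * z) * of_real (x - a))"
  proof (rule scalar_flow[OF _ _ x])
    show "(\<lambda>x. mode s l (N x)) integrable_on {a..b}"
      using integrable_linear[OF int bounded_linear_mode, of s l] by (simp add: o_def)
    show "mode s l (N y) = mode s l (N a) + (- s * z) * integral {a..y} (\<lambda>t. mode s l (N t))"
      if "y \<in> {a..<b}" for y
      using eq[OF that] s unfolding J_equation_modes mode_integral[OF sub[OF that]] by blast
  qed
  thus "mode s l (N x) = mode s l (rotation (z * of_real (x - a)) ** N a)"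
    unfolding mode_rotation[OF s] by (simp add: mult.assoc mult.commute)
qed

lemma flow_integral:
  fixes N :: "real \<Rightarrow> complex^2^2"
  assumes int: "N integrable_on {a..b}"
    and eq: "\<And>x. x \<in> {a..<b} \<Longrightarrow> N x = rotation (z * of_real (x - a)) ** N a"
    and x: "x \<in> {a..b}"
  shows "J ** (rotation (z * of_real (x - a)) ** N a) = J ** N a + mat z ** integral {a..x} N"
  unfolding J_equation_modes
proof (intro allI ballI)
  fix l :: 2 and s assume s: "s \<in> {\<i>, -\<i>}"
  have sub: "N integrable_on {a..x}"
    using x by (intro integrable_on_subinterval[OF int]) auto
  have "mode s l (N a) * exp ((- s * z) * of_real (x - a))
      = mode s l (N a) + (- s * z) * integral {a..x} (\<lambda>t. mode s l (N t))"
  proof (rule scalar_flow_integral[OF _ x])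
    show "mode s l (N y) = mode s l (N a) * exp ((- s * z) * of_real (y - a))"
      if "y \<in> {a..<b}" for y
      using arg_cong[OF eq[OF that], of "mode s l"] unfolding mode_rotation[OF s]
      by (simp add: mult.assoc mult.commute)
  qed
  thus "mode s l (rotation (z * of_real (x - a)) ** N a)
      = mode s l (N a) + (- s * z) * mode s l (integral {a..x} N)"
    unfolding mode_rotation[OF s] mode_integral[OF sub] by (simp add: mult.assoc mult.commute)
qed

section \<open>Regularity of functions of one real variable\<close>

text \<open>
  The function is the limit of its values at the grid points immediately to the right of the
  argument, which depend on the argument only through an integer.
\<close>

lemma borel_measurable_right_continuous:
  fixes f :: "real \<Rightarrow> 'a::metric_space"
  assumes "\<And>x. continuous (at_right x) f"
  shows "f \<in> borel_measurable borel"
proof (rule borel_measurable_LIMSEQ_metric)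
  (* The grid of step 1 / (n + 1); adding 1 to the floor puts the grid point strictly to the right of t. *)
  let ?g = "\<lambda>n t. (of_int \<lfloor>t * real (Suc n)\<rfloor> + 1) / real (Suc n)"
  show "(\<lambda>t. f (?g n t)) \<in> borel_measurable borel" for n
  proof -
    have "(\<lambda>t. \<lfloor>t * real (Suc n)\<rfloor>) \<in> measurable borel (count_space UNIV)" by measurable
    moreover have "(\<lambda>m::int. f ((of_int m + 1) / real (Suc n))) \<in> measurable (count_space UNIV) borel" by simp
    ultimately show ?thesis by (rule measurable_compose)
  qed
  fix t :: real
  have gt: "t < ?g n t" and le: "?g n t \<le> t + 1 / real (Suc n)" for n
  proof -
    have "t * real (Suc n) < of_int \<lfloor>t * real (Suc n)\<rfloor> + 1" by linarith
    thus "t < ?g n t" by (simp only: pos_less_divide_eq of_nat_0_less_iff zero_less_Suc)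
    have "?g n t \<le> (t * real (Suc n) + 1) / real (Suc n)"
      by (intro divide_right_mono) auto
    also have "\<dots> = t + 1 / real (Suc n)" by (simp add: add_divide_distrib)
    finally show "?g n t \<le> t + 1 / real (Suc n)" .
  qed
  have "(\<lambda>n. t + 1 / real (Suc n)) \<longlonglongrightarrow> t + 0"
    by (intro tendsto_intros LIMSEQ_inverse_real_of_nat[unfolded inverse_eq_divide])
  hence "(\<lambda>n. ?g n t) \<longlonglongrightarrow> t"
    using tendsto_sandwich[of "\<lambda>_. t" "\<lambda>n. ?g n t" sequentially "\<lambda>n. t + 1 / real (Suc n)" t]
      always_eventually[of "\<lambda>n. t \<le> ?g n t"] always_eventually[of "\<lambda>n. ?g n t \<le> t + 1 / real (Suc n)"]
      gt[THEN less_imp_le] le by (simp only: tendsto_const add_0_right simp_thms)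
  moreover have "?g n t \<in> {t<..} \<and> ?g n t \<noteq> t" for n
    using gt[of n] by (metis greaterThan_iff less_irrefl)
  ultimately have "filterlim (\<lambda>n. ?g n t) (at_right t) sequentially"
    unfolding filterlim_at by (intro conjI always_eventually) blast+
  moreover have "(f \<longlongrightarrow> f t) (at_right t)" using assms[of t] by (simp add: continuous_within)
  ultimately show "(\<lambda>n. f (?g n t)) \<longlonglongrightarrow> f t" by (rule filterlim_compose[rotated])
qed

lemma bounded_image_if_locally_bounded_variation:
  assumes "locally_bounded_variation f"
  shows "bounded (f ` {a..b})"
proof -
  obtain B where B: "\<And>n t. mono t \<Longrightarrow> range t \<subseteq> {a..b} \<Longrightarrow>
      (\<Sum>i<n. norm (f (t (Suc i)) - f (t i))) \<le> B"
    using assms unfolding locally_bounded_variation_def by metis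
  have "norm (f x) \<le> norm (f a) + B" if "x \<in> {a..b}" for x
  proof -
    (* A sequence with the single jump from a to x bounds the distance of the values at a and x. *)
    define t where "t = (\<lambda>n::nat. if n = 0 then a else x)"
    have "mono t" "range t \<subseteq> {a..b}" using that by (auto simp: t_def mono_def)
    from B[OF this, of 1] have "norm (f x - f a) \<le> B" by (simp add: t_def)
    thus ?thesis using norm_triangle_sub[of "f x" "f a"] by linarith
  qed
  thus ?thesis unfolding bounded_iff by blast
qed

text \<open>
  The variation is bounded by the increment of \<open>h\<close> because the increments of \<open>h\<close> telescope.
\<close>

lemma locally_bounded_variationI:
  assumes "\<And>a b. \<exists>h::real \<Rightarrow> real. \<forall>s t. a \<le> s \<longrightarrow> s \<le> t \<longrightarrow> t \<le> b \<longrightarrow> norm (f t - f s) \<le> h t - h s"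
  shows "locally_bounded_variation f"
  unfolding locally_bounded_variation_def
proof (intro allI)
  fix a b :: real
  obtain h :: "real \<Rightarrow> real" where h: "\<And>s t. a \<le> s \<Longrightarrow> s \<le> t \<Longrightarrow> t \<le> b \<Longrightarrow> norm (f t - f s) \<le> h t - h s"
    using assms[of a b] by blast
  have "(\<Sum>i<n. norm (f (t (Suc i)) - f (t i))) \<le> h b - h a"
    if t: "mono t" "range t \<subseteq> {a..b}" for n and t :: "nat \<Rightarrow> real"
  proof -
    have tab: "a \<le> t i" "t i \<le> b" for i using t(2) by (auto simp: image_subset_iff)
    have "(\<Sum>i<n. norm (f (t (Suc i)) - f (t i))) \<le> (\<Sum>i<n. h (t (Suc i)) - h (t i))"
      by (intro sum_mono h tab monoD[OF t(1)]) simp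
    also have "\<dots> = h (t n) - h (t 0)" by (rule sum_lessThan_telescope)
    also have "\<dots> \<le> h b - h a"
      using order_trans[OF norm_ge_zero h[of "t n" b]] order_trans[OF norm_ge_zero h[of a "t 0"]] tab
      by (smt (verit))
    finally show ?thesis .
  qed
  thus "\<exists>B. \<forall>n t. mono t \<and> range t \<subseteq> {a..b} \<longrightarrow> (\<Sum>i<n. norm (f (t (Suc i)) - f (t i))) \<le> B"
    by blast
qed

lemma set_integrable_bounded:
  fixes f :: "real \<Rightarrow> 'a::euclidean_space"
  assumes "f \<in> borel_measurable borel" "bounded (f ` {a..b})"
  shows "set_integrable lborel {a..b} f"
proof -
  obtain B where "\<forall>y\<in>f ` {a..b}. norm y \<le> B" using assms(2) unfolding bounded_iff by blast
  thus ?thesis unfolding set_integrable_def using assms(1)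
    by (intro integrableI_bounded_set_indicator[of _ _ _ B]) (auto simp: emeasure_lborel_Icc_eq)
qed

lemma borel_measurable_entry:
  fixes N :: "real \<Rightarrow> complex^2^2"
  assumes "N \<in> borel_measurable borel"
  shows "(\<lambda>t. N t $ i $ l) \<in> borel_measurable borel"
proof -
  have "(\<lambda>M::complex^2^2. M $ i $ l) \<in> borel_measurable borel"
    by (intro borel_measurable_continuous_onI continuous_intros)
  from measurable_compose[OF assms this] show ?thesis .
qed

section \<open>The solution of the Dirac system\<close>

text \<open>
  The contribution of a lattice point with weight \<open>c\<close> to the integral, where \<open>M\<close> is the value of
  the solution at that point.
\<close>

definition jump_term :: "complex \<Rightarrow> complex^2^2 \<Rightarrow> complex^2^2" where
  "jump_term c M = (kick c - mat 1) ** J ** M"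

text \<open>
  The factor \<open>gmat\<close> differs from the identity only at lattice points, a null set for the Lebesgue
  part, whereas the potential charges nothing but lattice points.
\<close>

lemma persson_integral_point_masses:
  fixes N :: "real \<Rightarrow> complex^2^2"
  assumes ell: "ell > 0" and N: "N \<in> borel_measurable borel" and bd: "\<And>a b. bounded (N ` {a..b})"
  shows "persson_integral (point_mass_sum ell c) z {..x} N
    = (\<Sum>k | ell * real k \<le> x. jump_term (c k) (N (ell * real k))) - mat z ** integral {0..x} N"
proof -
  let ?q = "point_mass_sum ell c"
  let ?X = "range (\<lambda>k. ell * real k)"
  define G where "G = (\<lambda>t. gmat (potential ?q {t} ** transpose J))"
  have qk: "?q {ell * real k} = c k" for k by (rule point_mass_sum_singleton[OF ell])
  have Gk: "G (ell * real k) = gmat (generator (c k))" for k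
    by (simp add: G_def generator_def potential_eq qk)
  have G1: "G t = mat 1" if "t \<notin> ?X" for t
  proof -
    have "{k. ell * real k \<in> {t}} = {}" using that by auto
    hence "?q {t} = 0" by (simp only: point_mass_sum_def sum.empty if_cancel)
    thus ?thesis using gmat_0 by (simp add: G_def generator_def potential_eq)
  qed
  have cX: "countable ?X" by simp
  have Gm: "(\<lambda>t. G t $ i $ j) \<in> borel_measurable borel" for i j
    by (rule measurable_discrete_difference[of "\<lambda>_. mat 1 $ i $ j", OF _ cX]) (auto simp: G1)
  have fin: "finite {k. ell * real k \<in> {..x}}"
  proof (rule finite_subset)
    show "{k. ell * real k \<in> {..x}} \<subseteq> {k. ell * real k \<in> {0..x}}" using ell by auto
  qed (rule finite_lattice_points[OF ell], simp)
  (* The part of the potential: a matrix product of gmat, the potential and N at each lattice point. *)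
  have disc: "(\<Sum>j\<in>UNIV. \<Sum>k\<in>UNIV.
       complex_integral (\<lambda>A. potential ?q A $ j $ k) {..x} (\<lambda>t. G t $ i $ j * N t $ k $ l))
     = (\<Sum>k | ell * real k \<le> x. jump_term (c k) (N (ell * real k))) $ i $ l" for i l
  proof -
    have "complex_integral (\<lambda>A. potential ?q A $ j $ k) {..x} (\<lambda>t. G t $ i $ j * N t $ k $ l)
        = (\<Sum>n | ell * real n \<le> x. potential_matrix (c n) $ j $ k *
             (gmat (generator (c n)) $ i $ j * N (ell * real n) $ k $ l))" for j k
      by (subst complex_integral_point_masses[OF ell _ _ fin])
         (auto simp: Gk potential_eq qk intro!: borel_measurable_times Gm borel_measurable_entry N)
    hence "(\<Sum>j\<in>UNIV. \<Sum>k\<in>UNIV.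
         complex_integral (\<lambda>A. potential ?q A $ j $ k) {..x} (\<lambda>t. G t $ i $ j * N t $ k $ l))
      = (\<Sum>n | ell * real n \<le> x. (gmat (generator (c n)) ** potential_matrix (c n) ** N (ell * real n)) $ i $ l)"
      by (simp add: sum_2 matrix_matrix_mult_def sum.distrib[symmetric] algebra_simps)
    thus ?thesis by (simp add: jump_term_def gmat_jump)
  qed
  (* The Lebesgue part, where gmat is the identity off the lattice. *)
  have cont: "(LINT t:{..x}|lborel. of_real (indicat_real {0..} t) * (G t ** N t) $ i $ l)
      = (integral {0..x} N) $ i $ l" for i l
  proof -
    have "(LINT t:{..x}|lborel. of_real (indicat_real {0..} t) * (G t ** N t) $ i $ l)
        = (LINT t:{0..x}|lborel. N t $ i $ l)"
      unfolding set_lebesgue_integral_def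
      by (rule integral_discrete_difference[OF cX]) (auto simp: G1 indicator_def)
    also have "bounded ((\<lambda>t. N t $ i $ l) ` {0..x})"
      using bounded_linear_image[OF bd[of 0 x]
          bounded_linear_compose[OF bounded_linear_vec_nth[of l] bounded_linear_vec_nth[of i]]]
      by (simp add: image_image)
    hence "(LINT t:{0..x}|lborel. N t $ i $ l) = integral {0..x} (\<lambda>t. N t $ i $ l)"
      by (intro set_borel_integral_eq_integral set_integrable_bounded borel_measurable_entry N)
    also have "\<dots> = (integral {0..x} N) $ i $ l"
      using integral_linear[OF set_borel_integral_eq_integral(1)[OF set_integrable_bounded[OF N bd]]
          bounded_linear_compose[OF bounded_linear_vec_nth[of l] bounded_linear_vec_nth[of i]], of 0 x]
      by (simp add: o_def)
    finally show ?thesis .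
  qed
  show ?thesis
    unfolding persson_integral_def Let_def G_def[symmetric] disc cont
    by (simp add: vec_eq_iff matrix_matrix_mult_def sum_2 forall_2 mat_def)
qed

text \<open>
  The left limit of the solution at the lattice point number \<open>k\<close>.
\<close>

primrec pre_jump :: "real \<Rightarrow> (nat \<Rightarrow> complex) \<Rightarrow> complex \<Rightarrow> nat \<Rightarrow> complex^2^2" where
  "pre_jump ell c z 0 = mat 1"
| "pre_jump ell c z (Suc k) = rotation (z * of_real ell) ** (kick (c k) ** pre_jump ell c z k)"

definition discrete_solution :: "real \<Rightarrow> (nat \<Rightarrow> complex) \<Rightarrow> complex \<Rightarrow> real \<Rightarrow> complex^2^2" where
  "discrete_solution ell c z x = (if x < 0 then mat 1 else
     let k = nat \<lfloor>x / ell\<rfloor> in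
       rotation (z * of_real (x - ell * real k)) ** (kick (c k) ** pre_jump ell c z k))"

lemma cell_iff:
  assumes "ell > 0"
  shows "x \<in> {ell * real k..<ell * real (Suc k)} \<longleftrightarrow> x \<ge> 0 \<and> nat \<lfloor>x / ell\<rfloor> = k"
proof -
  have "x \<in> {ell * real k..<ell * real (Suc k)} \<longleftrightarrow> real k \<le> x / ell \<and> x / ell < real k + 1"
    using assms by (simp add: pos_le_divide_eq pos_divide_less_eq mult.commute[of _ ell] add.commute)
  also have "\<dots> \<longleftrightarrow> \<lfloor>x / ell\<rfloor> = int k" by (simp add: floor_eq_iff)
  also have "\<dots> \<longleftrightarrow> x \<ge> 0 \<and> nat \<lfloor>x / ell\<rfloor> = k"
  proof -
    have "\<lfloor>x / ell\<rfloor> \<ge> 0 \<longleftrightarrow> x / ell \<ge> 0" by (rule zero_le_floor)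
    hence "\<lfloor>x / ell\<rfloor> \<ge> 0 \<longleftrightarrow> x \<ge> 0" using assms by (simp only: zero_le_divide_iff) auto
    thus ?thesis by (auto simp del: zero_le_floor)
  qed
  finally show ?thesis .
qed

lemma rotation_0: "rotation 0 = mat 1"
  by (simp add: rotation_def mat2_simps)

lemma discrete_solution_neg: "x < 0 \<Longrightarrow> discrete_solution ell c z x = mat 1"
  by (simp add: discrete_solution_def)

lemma discrete_solution_cell:
  assumes "ell > 0" "x \<in> {ell * real k..<ell * real (Suc k)}"
  shows "discrete_solution ell c z x
    = rotation (z * of_real (x - ell * real k)) ** (kick (c k) ** pre_jump ell c z k)"
  using assms(2) unfolding cell_iff[OF assms(1)] by (auto simp: discrete_solution_def)

lemma discrete_solution_lattice:
  assumes "ell > 0"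
  shows "discrete_solution ell c z (ell * real k) = kick (c k) ** pre_jump ell c z k"
  using discrete_solution_cell[OF assms, of "ell * real k" k c z] assms by (simp add: rotation_0)

lemma continuous_rotation_flow:
  fixes M :: "complex^2^2"
  shows "continuous_on UNIV (\<lambda>x::real. rotation (z * of_real (x - a)) ** M)"
proof -
  have "((\<lambda>x::real. rotation (z * of_real (x - a)) ** M) \<longlongrightarrow> rotation (z * of_real (y - a)) ** M) (at y)" for y
  proof (intro vec_tendstoI)
    fix i l :: 2
    show "((\<lambda>x::real. (rotation (z * of_real (x - a)) ** M) $ i $ l) \<longlongrightarrow>
        (rotation (z * of_real (y - a)) ** M) $ i $ l) (at y)"
      using exhaust_2[of i]
      by (elim disjE; simp only: matrix_matrix_mult_def sum_2 rotation_def vec_lambda_beta vector_2)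
         (intro tendsto_intros)+
  qed
  thus ?thesis by (simp add: continuous_on_def)
qed

lemma discrete_solution_right_continuous:
  assumes "ell > 0"
  shows "continuous (at_right x) (discrete_solution ell c z)"
proof (cases "x < 0")
  case True
  have "\<forall>\<^sub>F y in at_right x. y < 0" using eventually_at_right_real[OF True] by (auto elim: eventually_mono)
  hence "\<forall>\<^sub>F y in at_right x. mat 1 = discrete_solution ell c z y"
    by eventually_elim (simp add: discrete_solution_neg)
  from Lim_transform_eventually[OF tendsto_const this]
  show ?thesis using True by (simp add: continuous_within discrete_solution_neg)
next
  case False
  define k where "k = nat \<lfloor>x / ell\<rfloor>"
  define g where "g = (\<lambda>y. rotation (z * of_real (y - ell * real k)) ** (kick (c k) ** pre_jump ell c z k))"
  have x: "x \<in> {ell * real k..<ell * real (Suc k)}"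
    using False unfolding cell_iff[OF assms] by (simp add: k_def)
  have "x < ell * real (Suc k)" using x by simp
  from eventually_at_right_real[OF this]
  have "\<forall>\<^sub>F y in at_right x. g y = discrete_solution ell c z y"
  proof eventually_elim
    case (elim y)
    hence "y \<in> {ell * real k..<ell * real (Suc k)}" using x by simp
    from discrete_solution_cell[OF assms this] show ?case by (simp only: g_def)
  qed
  moreover have "isCont g x"
    using continuous_rotation_flow[of z "ell * real k" "kick (c k) ** pre_jump ell c z k"]
    by (simp only: g_def continuous_on_eq_continuous_at open_UNIV) blast
  hence "(g \<longlongrightarrow> g x) (at_right x)"
    using continuous_at_imp_continuous_within continuous_within by blast
  moreover have "g x = discrete_solution ell c z x" using discrete_solution_cell[OF assms x] by (simp add: g_def)
  ultimately show ?thesis using Lim_transform_eventually by (fastforce simp: continuous_within)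
qed

lemma discrete_solution_bounded:
  assumes "ell > 0"
  shows "bounded (discrete_solution ell c z ` {a..b})"
proof -
  define g where "g = (\<lambda>k y. rotation (z * of_real (y - ell * real k)) ** (kick (c k) ** pre_jump ell c z k))"
  have "discrete_solution ell c z x \<in> {mat 1} \<union> (\<Union>k\<le>nat \<lfloor>b / ell\<rfloor>. g k ` {ell * real k..ell * real (Suc k)})"
    if x: "x \<in> {a..b}" for x
  proof (cases "x < 0")
    case False
    define k where "k = nat \<lfloor>x / ell\<rfloor>"
    have *: "x \<in> {ell * real k..<ell * real (Suc k)}"
      using False unfolding cell_iff[OF assms] by (simp add: k_def)
    have "k \<le> nat \<lfloor>b / ell\<rfloor>"
      unfolding k_def using x assms by (intro nat_mono floor_mono divide_right_mono) auto
    moreover have "discrete_solution ell c z x = g k x"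
      using discrete_solution_cell[OF assms *] by (simp add: g_def)
    ultimately show ?thesis using * by force
  qed (simp add: discrete_solution_neg)
  moreover have "bounded ({mat 1} \<union> (\<Union>k\<le>nat \<lfloor>b / ell\<rfloor>. g k ` {ell * real k..ell * real (Suc k)}))"
    unfolding g_def
    by (intro bounded_Un[THEN iffD2] conjI bounded_UN ballI compact_imp_bounded
        compact_continuous_image continuous_on_subset[OF continuous_rotation_flow]) auto
  ultimately show ?thesis by (meson bounded_subset image_subsetI)
qed

lemma lattice_points_below:
  assumes "ell > 0" "x \<in> {ell * real k..<ell * real (Suc k)}"
  shows "{j. ell * real j \<le> x} = {..k}"
proof -
  have "ell * real j \<le> x \<longleftrightarrow> j \<le> k" for j
  proof
    assume "ell * real j \<le> x"
    hence "ell * real j < ell * real (Suc k)" using assms(2) by auto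
    thus "j \<le> k" using assms(1) by (simp only: mult_less_cancel_left_pos of_nat_less_iff less_Suc_eq_le)
  next
    assume "j \<le> k"
    hence "ell * real j \<le> ell * real k" using assms(1) by simp
    thus "ell * real j \<le> x" using assms(2) by (meson atLeastLessThan_iff order_trans)
  qed
  thus ?thesis by auto
qed

lemma jump_condition:
  "J ** M + jump_term c M = J ** M' \<longleftrightarrow> M = kick c ** M'"
proof -
  have "J ** M + jump_term c M = kick c ** J ** M"
    by (simp add: jump_term_def mat2_simps algebra_simps)
  thus ?thesis by (simp add: kick_equation)
qed

text \<open>
  Persson's equation with the integral against the potential evaluated as a sum over the lattice.
\<close>

definition reduced_equation :: "real \<Rightarrow> (nat \<Rightarrow> complex) \<Rightarrow> complex \<Rightarrow> (real \<Rightarrow> complex^2^2) \<Rightarrow> bool" where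
  "reduced_equation ell c z N \<longleftrightarrow> (\<forall>x. J ** N x
     + ((\<Sum>k | ell * real k \<le> x. jump_term (c k) (N (ell * real k))) - mat z ** integral {0..x} N) = J)"

lemma integral_cell:
  fixes N :: "real \<Rightarrow> complex^2^2"
  assumes "\<And>a b. N integrable_on {a..b}" "0 \<le> a" "a \<le> x"
  shows "mat z ** integral {0..x} N = mat z ** integral {0..a} N + mat z ** integral {a..x} N"
  using Henstock_Kurzweil_Integration.integral_combine[OF assms(2,3) assms(1)] by (metis matrix_add_ldistrib)

text \<open>
  With \<open>q\<close>, \<open>s\<close>, \<open>u\<close> the terms of the reduced equation at a lattice point, this turns the equation at a
  later point into a condition on the increments alone; \<open>y\<close> is the term of a new jump.
\<close>

lemma balance_iff:
  fixes w :: "'a::ab_group_add"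
  assumes "q + (s - u) = w"
  shows "p + ((s + y) - (u + v)) = w \<longleftrightarrow> p + y = q + v"
proof -
  have "p + ((s + y) - (u + v)) - (q + (s - u)) = p + y - (q + v)" by (simp add: algebra_simps)
  thus ?thesis unfolding assms[symmetric] by (metis right_minus_eq)
qed

text \<open>
  Within a cell the equation forces the flow, and at the next lattice point it forces the jump, so
  the solution is determined from left to right.
\<close>

lemma reduced_equation_unique:
  assumes ell: "ell > 0" and int: "\<And>a b. N integrable_on {a..b}"
    and eq: "reduced_equation ell c z N"
  shows "N = discrete_solution ell c z"
proof -
  let ?V = "\<lambda>k. jump_term (c k) (N (ell * real k))"
  let ?Z = "\<lambda>a b. mat z ** integral {a..b} N"
  have E: "J ** N x + ((\<Sum>k | ell * real k \<le> x. ?V k) - ?Z 0 x) = J" for x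
    using eq by (simp add: reduced_equation_def)
  have cell: "J ** N x + ((\<Sum>j\<le>k. ?V j) - ?Z 0 x) = J" if "x \<in> {ell * real k..<ell * real (Suc k)}" for k x
    using E[of x] lattice_points_below[OF ell that] by simp
  have lat: "ell * real k \<in> {ell * real k..<ell * real (Suc k)}" for k using ell by simp
  have flow: "N x = rotation (z * of_real (x - ell * real k)) ** N (ell * real k)"
    if x: "x \<in> {ell * real k..<ell * real (Suc k)}" for k x
  proof (rule flow_solution[OF int _ x])
    fix y assume y: "y \<in> {ell * real k..<ell * real (Suc k)}"
    have "?Z 0 y = ?Z 0 (ell * real k) + ?Z (ell * real k) y"
      using y ell by (intro integral_cell int) auto
    thus "J ** N y = J ** N (ell * real k) + ?Z (ell * real k) y"
      using cell[OF y] balance_iff[OF cell[OF lat, of k], of _ 0] by simp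
  qed
  have flow_end: "J ** (rotation (z * of_real ell) ** N (ell * real k))
      = J ** N (ell * real k) + ?Z (ell * real k) (ell * real (Suc k))" for k
  proof -
    have end_cell: "ell * real (Suc k) \<in> {ell * real k..ell * real (Suc k)}" using ell by simp
    show ?thesis using flow_integral[OF int flow end_cell] by (simp add: algebra_simps)
  qed
  have lattice: "N (ell * real k) = kick (c k) ** pre_jump ell c z k" for k
  proof (induction k)
    case 0
    have "J ** N 0 + jump_term (c 0) (N 0) = J ** mat 1" using cell[OF lat, of 0] by (simp add: matrix_mul_rid)
    thus ?case unfolding jump_condition by simp
  next
    case (Suc k)
    have "?Z 0 (ell * real (Suc k)) = ?Z 0 (ell * real k) + ?Z (ell * real k) (ell * real (Suc k))"
      using ell by (intro integral_cell int) auto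
    hence "J ** N (ell * real (Suc k)) + ?V (Suc k)
        = J ** N (ell * real k) + ?Z (ell * real k) (ell * real (Suc k))"
      using cell[OF lat, of "Suc k"] balance_iff[OF cell[OF lat, of k]] by (simp only: sum.atMost_Suc)
    also have "\<dots> = J ** (rotation (z * of_real ell) ** N (ell * real k))" by (rule flow_end[symmetric])
    finally show ?case unfolding jump_condition by (simp add: Suc)
  qed
  show ?thesis
  proof
    fix x
    show "N x = discrete_solution ell c z x"
    proof (cases "x < 0")
      case True
      have "ell * real k \<le> x \<longleftrightarrow> False" for k
        using True ell by (smt (verit) mult_nonneg_nonneg of_nat_0_le_iff)
      hence "J ** N x = J ** mat 1" using E[of x] True by (simp add: matrix_mul_rid mat2_simps)
      thus ?thesis unfolding J_cancel discrete_solution_neg[OF True] .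
    next
      case False
      hence "x \<in> {ell * real (nat \<lfloor>x / ell\<rfloor>)..<ell * real (Suc (nat \<lfloor>x / ell\<rfloor>))}"
        unfolding cell_iff[OF ell] by simp
      thus ?thesis using flow lattice discrete_solution_cell[OF ell] by simp
    qed
  qed
qed

lemma reduced_equation_discrete_solution:
  assumes ell: "ell > 0" and int: "\<And>a b. discrete_solution ell c z integrable_on {a..b}"
  shows "reduced_equation ell c z (discrete_solution ell c z)"
proof -
  define N where "N = discrete_solution ell c z"
  let ?V = "\<lambda>k. jump_term (c k) (N (ell * real k))"
  let ?Z = "\<lambda>a b. mat z ** integral {a..b} N"
  have int: "N integrable_on {a..b}" for a b using int by (simp add: N_def)
  have lattice: "N (ell * real k) = kick (c k) ** pre_jump ell c z k" for k
    unfolding N_def by (rule discrete_solution_lattice[OF ell])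
  have flow: "J ** (rotation (z * of_real (x - ell * real k)) ** N (ell * real k))
      = J ** N (ell * real k) + ?Z (ell * real k) x"
    if x: "x \<in> {ell * real k..ell * real (Suc k)}" for k x
  proof (rule flow_integral[OF int _ x])
    show "N y = rotation (z * of_real (y - ell * real k)) ** N (ell * real k)"
      if "y \<in> {ell * real k..<ell * real (Suc k)}" for y
      unfolding lattice unfolding N_def by (rule discrete_solution_cell[OF ell that])
  qed
  have at_lattice: "J ** N (ell * real k) + ((\<Sum>j\<le>k. ?V j) - ?Z 0 (ell * real k)) = J" for k
  proof (induction k)
    case 0
    have "J ** N (ell * real 0) + ?V 0 = J ** mat 1" unfolding jump_condition lattice by simp
    moreover have "?Z 0 (ell * real 0) = 0" by (simp add: mat2_simps)
    ultimately show ?case by (simp add: matrix_mul_rid)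
  next
    case (Suc k)
    have "J ** N (ell * real (Suc k)) + ?V (Suc k) = J ** (rotation (z * of_real ell) ** N (ell * real k))"
      unfolding jump_condition lattice by simp
    also have "\<dots> = J ** N (ell * real k) + ?Z (ell * real k) (ell * real (Suc k))"
      using flow[of "ell * real (Suc k)" k] ell by (simp add: algebra_simps)
    finally have "J ** N (ell * real (Suc k)) + ?V (Suc k)
        = J ** N (ell * real k) + ?Z (ell * real k) (ell * real (Suc k))" .
    moreover have "?Z 0 (ell * real (Suc k)) = ?Z 0 (ell * real k) + ?Z (ell * real k) (ell * real (Suc k))"
      using ell by (intro integral_cell int) auto
    ultimately show ?case using balance_iff[OF Suc] by (simp only: sum.atMost_Suc)
  qed
  have "J ** N x + ((\<Sum>k | ell * real k \<le> x. ?V k) - ?Z 0 x) = J" for x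
  proof (cases "x < 0")
    case True
    have "ell * real k \<le> x \<longleftrightarrow> False" for k
      using True ell by (smt (verit) mult_nonneg_nonneg of_nat_0_le_iff)
    thus ?thesis using True by (simp add: N_def discrete_solution_neg mat2_simps)
  next
    case False
    define k where "k = nat \<lfloor>x / ell\<rfloor>"
    have x: "x \<in> {ell * real k..<ell * real (Suc k)}"
      using False unfolding cell_iff[OF ell] by (simp add: k_def)
    have "N x = rotation (z * of_real (x - ell * real k)) ** N (ell * real k)"
      unfolding lattice unfolding N_def by (rule discrete_solution_cell[OF ell x])
    hence "J ** N x = J ** N (ell * real k) + ?Z (ell * real k) x" using flow[of x k] x by simp
    moreover have "?Z 0 x = ?Z 0 (ell * real k) + ?Z (ell * real k) x"
      using x ell by (intro integral_cell int) auto
    moreover have "J ** N x + (((\<Sum>j\<le>k. ?V j) + 0) - (?Z 0 (ell * real k) + ?Z (ell * real k) x)) = J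
        \<longleftrightarrow> J ** N x + 0 = J ** N (ell * real k) + ?Z (ell * real k) x"
      by (rule balance_iff[OF at_lattice])
    ultimately show ?thesis by (simp only: lattice_points_below[OF ell x] add_0_right)
  qed
  thus ?thesis unfolding reduced_equation_def N_def by blast
qed

lemma discrete_solution_integrable:
  assumes "ell > 0"
  shows "discrete_solution ell c z integrable_on {a..b}"
  using discrete_solution_bounded[OF assms] discrete_solution_right_continuous[OF assms]
  by (intro set_borel_integral_eq_integral(1) set_integrable_bounded borel_measurable_right_continuous)

text \<open>
  The interval of integration is empty when the end point is negative, whence the maximum with 0.
\<close>

lemma norm_integral_increment:
  fixes P :: "real \<Rightarrow> 'a::euclidean_space"
  assumes int: "\<And>a b. P integrable_on {a..b}" and B: "\<And>x. x \<in> {0..b} \<Longrightarrow> norm (P x) \<le> B"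
    and st: "s \<le> t" "t \<le> b"
  shows "norm (integral {0..t} P - integral {0..s} P) \<le> B * max 0 t - B * max 0 s"
proof (cases "t < 0")
  case True
  thus ?thesis using st by simp
next
  case False
  have "integral {0..s} P = integral {0..max 0 s} P" by (cases "s < 0") (auto simp: max_def)
  moreover have "integral {0..max 0 s} P + integral {max 0 s..t} P = integral {0..t} P"
    using False st by (intro Henstock_Kurzweil_Integration.integral_combine int) auto
  ultimately have "integral {0..t} P - integral {0..s} P = integral {max 0 s..t} P"
    by (metis add_diff_cancel_left')
  also have "norm \<dots> \<le> B * (t - max 0 s)"
  proof -
    have "(P has_integral integral {max 0 s..t} P) {max 0 s..t}" using int by (rule integrable_integral)
    moreover have "0 \<le> B" using order_trans[OF norm_ge_zero B[of t]] False st by simp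
    ultimately have "norm (integral {max 0 s..t} P) \<le> B * measure lborel {max 0 s..t}"
      using st by (intro has_integral_bound_real[of B "{}" P]) (auto intro!: B)
    thus ?thesis using False st by simp
  qed
  finally show ?thesis using False by (simp add: algebra_simps)
qed

text \<open>
  By the reduced equation the solution is a step function plus the integral of a locally bounded
  function, and the increments of both are dominated by those of a monotone function.
\<close>

lemma discrete_solution_bounded_variation:
  assumes ell: "ell > 0"
  shows "locally_bounded_variation (discrete_solution ell c z)"
proof (rule locally_bounded_variationI)
  fix a b :: real
  define N where "N = discrete_solution ell c z"
  define P where "P = (\<lambda>t. transpose J ** (mat z ** N t))"
  define U where "U = (\<lambda>k. transpose J ** jump_term (c k) (N (ell * real k)))"
  have lin: "bounded_linear (\<lambda>M. transpose J ** (mat z ** M))"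
    by (rule linear_conv_bounded_linear[THEN iffD1], rule linearI)
       (simp_all add: mat2_simps algebra_simps scaleR_complex)
  have int: "N integrable_on {a..b}" for a b
    unfolding N_def by (rule discrete_solution_integrable[OF ell])
  have intP: "P integrable_on {a..b}" for a b
    using integrable_linear[OF int lin] by (simp add: P_def o_def)
  have iP: "integral {0..x} P = transpose J ** (mat z ** integral {0..x} N)" for x
    using integral_linear[OF int lin] by (simp add: P_def o_def)
  have "bounded (P ` {0..b})"
    using bounded_linear_image[OF discrete_solution_bounded[OF ell] lin]
    by (simp add: P_def N_def image_image)
  then obtain B where "\<forall>y\<in>P ` {0..b}. norm y \<le> B" unfolding bounded_iff by blast
  hence B: "norm (P x) \<le> B" if "x \<in> {0..b}" for x using that by blast
  have N: "N x = mat 1 - (\<Sum>k | ell * real k \<le> x. U k) + integral {0..x} P" for x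
  proof -
    have "J ** N x + ((\<Sum>k | ell * real k \<le> x. jump_term (c k) (N (ell * real k)))
        - mat z ** integral {0..x} N) = J"
      using reduced_equation_discrete_solution[OF ell discrete_solution_integrable[OF ell], of c z]
      unfolding reduced_equation_def N_def by blast
    hence "J ** N x = J - (\<Sum>k | ell * real k \<le> x. jump_term (c k) (N (ell * real k)))
        + mat z ** integral {0..x} N" by (simp add: algebra_simps)
    hence "transpose J ** (J ** N x) = transpose J ** (J
        - (\<Sum>k | ell * real k \<le> x. jump_term (c k) (N (ell * real k))) + mat z ** integral {0..x} N)" by simp
    moreover have "transpose J ** (J ** M) = M" for M :: "complex^2^2" by (simp add: mat2_simps)
    moreover have "transpose J ** (J - S + K) = mat 1 - transpose J ** S + transpose J ** K" for S K :: "complex^2^2"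
      by (simp add: mat2_simps)
    moreover have "transpose J ** (\<Sum>k\<in>K. f k) = (\<Sum>k\<in>K. transpose J ** f k)" for f :: "nat \<Rightarrow> complex^2^2" and K
      by (rule linear_sum, rule linearI) (simp_all add: mat2_simps algebra_simps scaleR_complex)
    ultimately show ?thesis by (simp only: iP U_def)
  qed
  define h where "h = (\<lambda>x. (\<Sum>k | ell * real k \<le> x. norm (U k)) + B * max 0 x)"
  have "norm (N t - N s) \<le> h t - h s" if "s \<le> t" "t \<le> b" for s t
  proof -
    let ?K = "\<lambda>x. {k. ell * real k \<le> x}"
    have fin: "finite (?K t)"
    proof (rule finite_subset)
      show "?K t \<subseteq> {k. ell * real k \<in> {0..t}}" using ell by auto
    qed (rule finite_lattice_points[OF ell], simp)
    have sub: "?K s \<subseteq> ?K t" using that by auto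
    note split = sum_diff[OF fin sub]
    have "N t - N s = (integral {0..t} P - integral {0..s} P) - (\<Sum>k\<in>?K t - ?K s. U k)"
      unfolding N[of t] N[of s] by (simp add: split)
    also have "norm \<dots> \<le> norm (integral {0..t} P - integral {0..s} P) + norm (\<Sum>k\<in>?K t - ?K s. U k)"
      by (rule norm_triangle_ineq4)
    also have "\<dots> \<le> (B * max 0 t - B * max 0 s) + (\<Sum>k\<in>?K t - ?K s. norm (U k))"
      by (intro add_mono norm_integral_increment[OF intP B that] norm_sum)
    also have "\<dots> = h t - h s" by (simp add: h_def split[symmetric])
    finally show ?thesis .
  qed
  thus "\<exists>h::real \<Rightarrow> real. \<forall>s t. a \<le> s \<longrightarrow> s \<le> t \<longrightarrow> t \<le> b \<longrightarrow>
      norm (discrete_solution ell c z t - discrete_solution ell c z s) \<le> h t - h s"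
    unfolding N_def by blast
qed

lemma dirac_solution_point_masses:
  assumes ell: "ell > 0"
  shows "dirac_solution (point_mass_sum ell c) z = discrete_solution ell c z"
  unfolding dirac_solution_def
proof (rule the_equality)
  have meas: "N \<in> borel_measurable borel" and bd: "bounded (N ` {a..b})"
    if "\<forall>x. continuous (at_right x) N" "locally_bounded_variation N" for N :: "real \<Rightarrow> complex^2^2" and a b
    using that by (auto intro: borel_measurable_right_continuous bounded_image_if_locally_bounded_variation)
  have iff: "(\<forall>x. J ** N x + persson_integral (point_mass_sum ell c) z {..x} N = J) \<longleftrightarrow> reduced_equation ell c z N"
    if "\<forall>x. continuous (at_right x) N" "locally_bounded_variation N" for N
    unfolding reduced_equation_def persson_integral_point_masses[OF ell meas[OF that] bd[OF that]] ..
  show "is_dirac_solution (point_mass_sum ell c) z (discrete_solution ell c z)"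
    unfolding is_dirac_solution_def
    using iff[OF _ discrete_solution_bounded_variation[OF ell]]
      discrete_solution_right_continuous[OF ell] discrete_solution_bounded_variation[OF ell]
      reduced_equation_discrete_solution[OF ell discrete_solution_integrable[OF ell]] by blast
  fix N assume N: "is_dirac_solution (point_mass_sum ell c) z N"
  hence r: "\<forall>x. continuous (at_right x) N" "locally_bounded_variation N"
    by (auto simp: is_dirac_solution_def)
  show "N = discrete_solution ell c z"
  proof (rule reduced_equation_unique[OF ell])
    show "N integrable_on {a..b}" for a b
      by (intro set_borel_integral_eq_integral(1) set_integrable_bounded meas[OF r] bd[OF r])
    show "reduced_equation ell c z N" using N iff[OF r] by (simp add: is_dirac_solution_def)
  qed
qed

section \<open>The weights and the recurrence coefficients\<close>

text \<open>
  At \<open>c = 0\<close> the division by zero gives the correct value 0.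
\<close>

definition schur_param :: "complex \<Rightarrow> complex" where
  "schur_param c = of_real (tanh (norm c) / norm c) * cnj c"

lemma norm_schur_param: "norm (schur_param c) = tanh (norm c)"
  by (cases "c = 0") (simp_all add: schur_param_def norm_mult norm_divide)

lemma norm_schur_param_less: "norm (schur_param c) < 1"
  by (simp add: norm_schur_param tanh_real_lt_1)

lemma varkappa_schur_param: "varkappa (schur_param c) = c"
proof (cases "c = 0")
  case True
  thus ?thesis by (simp add: varkappa_def schur_param_def)
next
  case False
  let ?r = "norm c"
  have t: "tanh ?r \<noteq> 0" using False by simp
  have "artanh (tanh ?r) = ?r" by (rule artanh_tanh_real)
  hence ln: "ln ((1 + tanh ?r) / (1 - tanh ?r)) = 2 * ?r" by (simp add: artanh_def)
  have "schur_param c \<noteq> 0" using norm_schur_param[of c] t by auto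
  hence "varkappa (schur_param c) = cnj (schur_param c) / of_real (2 * tanh ?r) * of_real (2 * ?r)"
    by (simp only: varkappa_def norm_schur_param ln if_False)
  also have "\<dots> = c" using False t by (simp add: schur_param_def)
  finally show ?thesis .
qed

lemma schur_param_varkappa:
  assumes "norm w < 1"
  shows "schur_param (varkappa w) = w"
proof (cases "w = 0")
  case True
  thus ?thesis by (simp add: varkappa_def schur_param_def)
next
  case False
  define s where "s = artanh (norm w)"
  have q: "(1 + norm w) / (1 - norm w) > 1" using assms False by (simp add: field_simps)
  hence s0: "s > 0" by (simp add: s_def artanh_def)
  have v: "varkappa w = of_real (s / norm w) * cnj w"
    using False by (simp add: varkappa_def s_def artanh_def)
  have nv: "norm (varkappa w) = s" using False s0 by (simp add: v norm_mult norm_divide)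
  have "exp (2 * s) = (1 + norm w) / (1 - norm w)" using q by (simp add: s_def artanh_def)
  moreover have "tanh s = (exp (2 * s) - 1) / (exp (2 * s) + 1)"
    by (simp add: tanh_def sinh_def cosh_def exp_double exp_minus power2_eq_square divide_simps)
  moreover have "(1 + norm w) / (1 - norm w) - 1 = 2 * norm w / (1 - norm w)"
    "(1 + norm w) / (1 - norm w) + 1 = 2 / (1 - norm w)"
    using assms by (simp_all add: divide_simps)
  ultimately have "tanh s = norm w" using assms by simp
  thus ?thesis using False s0 by (simp add: schur_param_def nv) (simp add: v)
qed

section \<open>The Weyl function\<close>

text \<open>
  Together with \<open>row_plus\<close> these are coordinates of the second row in which multiplication by a
  rotation from the right is diagonal.
\<close>

definition row_minus :: "complex^2^2 \<Rightarrow> complex" where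
  "row_minus M = M $ 2 $ 2 - \<i> * M $ 2 $ 1"

definition row_plus :: "complex^2^2 \<Rightarrow> complex" where
  "row_plus M = M $ 2 $ 2 + \<i> * M $ 2 $ 1"

text \<open>
  The Cayley transform of the quotient of the entries of the second row, written homogeneously: it
  makes sense also for the row of the identity, where that quotient is infinite and the value is 1.
\<close>

definition row_schur :: "complex^2^2 \<Rightarrow> complex" where
  "row_schur M = row_minus M / row_plus M"

lemma row_rotation:
  "row_plus (M ** rotation \<theta>) = exp (- (\<i> * \<theta>)) * row_plus M"
  "row_minus (M ** rotation \<theta>) = exp (\<i> * \<theta>) * row_minus M"
proof -
  have e: "exp (- (\<i> * \<theta>)) = cos \<theta> - \<i> * sin \<theta>" "exp (\<i> * \<theta>) = cos \<theta> + \<i> * sin \<theta>"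
    using exp_Euler[of \<theta>] exp_Euler[of "-\<theta>"] by simp_all
  show "row_plus (M ** rotation \<theta>) = exp (- (\<i> * \<theta>)) * row_plus M"
    unfolding e by (simp add: row_plus_def rotation_def matrix_matrix_mult_def sum_2 algebra_simps)
  show "row_minus (M ** rotation \<theta>) = exp (\<i> * \<theta>) * row_minus M"
    unfolding e by (simp add: row_minus_def rotation_def matrix_matrix_mult_def sum_2 algebra_simps)
qed

lemma row_kick:
  fixes c defines "C \<equiv> cosh (norm c)" and "S \<equiv> sinh (norm c) / norm c"
  shows "row_plus (M ** kick c) = of_real C * row_plus M + of_real S * c * row_minus M"
    and "row_minus (M ** kick c) = of_real C * row_minus M + of_real S * cnj c * row_plus M"
proof -
  have c: "c = of_real (Re c) + \<i> * of_real (Im c)" by (rule complex_eq)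
  have cc: "cnj c = of_real (Re c) - \<i> * of_real (Im c)" by (simp add: complex_eq_iff)
  have k: "kick c $ 1 $ 1 = of_real (C - S * Re c)" "kick c $ 1 $ 2 = of_real (S * Im c)"
    "kick c $ 2 $ 1 = of_real (S * Im c)" "kick c $ 2 $ 2 = of_real (C + S * Re c)"
    unfolding C_def S_def by (rule kick_entries)+
  have "row_plus (M ** kick c)
      = of_real C * row_plus M + of_real S * (of_real (Re c) + \<i> * of_real (Im c)) * row_minus M"
    by (simp add: row_plus_def row_minus_def matrix_matrix_mult_def sum_2 k algebra_simps)
  thus "row_plus (M ** kick c) = of_real C * row_plus M + of_real S * c * row_minus M"
    by (simp flip: c)
  show "row_minus (M ** kick c) = of_real C * row_minus M + of_real S * cnj c * row_plus M"
    unfolding cc by (simp add: row_plus_def row_minus_def matrix_matrix_mult_def sum_2 k algebra_simps)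
qed

lemma row_schur_rotation:
  assumes "row_plus M \<noteq> 0"
  shows "row_plus (M ** rotation \<theta>) \<noteq> 0"
    and "row_schur (M ** rotation \<theta>) = exp (2 * \<i> * \<theta>) * row_schur M"
proof -
  show "row_plus (M ** rotation \<theta>) \<noteq> 0" using assms by (simp add: row_rotation)
  have "exp (2 * \<i> * \<theta>) = exp (\<i> * \<theta>) / exp (- (\<i> * \<theta>))"
    by (simp add: mult.assoc flip: exp_diff)
  thus "row_schur (M ** rotation \<theta>) = exp (2 * \<i> * \<theta>) * row_schur M"
    by (simp add: row_schur_def row_rotation)
qed

text \<open>
  In the two coordinates of the row the matrix has the entries \<open>cosh |c|\<close> on the diagonal and
  \<open>sinh |c| * c / |c|\<close> and its conjugate off the diagonal; dividing by \<open>cosh |c|\<close> gives the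
  automorphism.
\<close>

lemma row_schur_kick:
  assumes "row_plus M \<noteq> 0" "norm (row_schur M) \<le> 1"
  shows "row_plus (M ** kick c) \<noteq> 0"
    and "row_schur (M ** kick c) = disk_aut (schur_param c) (row_schur M)"
proof -
  let ?r = "norm c"
  define C where "C = complex_of_real (cosh ?r)"
  have C0: "C \<noteq> 0" by (simp add: C_def)
  define a where "a = schur_param c"
  have S: "complex_of_real (sinh ?r / ?r) * cnj c = C * a"
    by (simp add: C_def a_def schur_param_def tanh_def)
  have S': "complex_of_real (sinh ?r / ?r) * c = C * cnj a"
    by (simp add: C_def a_def schur_param_def tanh_def)
  have m: "row_minus M = row_schur M * row_plus M" using assms(1) by (simp add: row_schur_def)
  have p: "row_plus (M ** kick c) = C * row_plus M * (1 + cnj a * row_schur M)"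
    unfolding row_kick S' by (simp add: m C_def[symmetric] algebra_simps)
  have n: "row_minus (M ** kick c) = C * row_plus M * (row_schur M + a)"
    unfolding row_kick S by (simp add: m C_def[symmetric] algebra_simps)
  have "norm a < 1" unfolding a_def by (rule norm_schur_param_less)
  hence d: "1 + cnj a * row_schur M \<noteq> 0" using assms(2) by (rule disk_aut_denominator)
  show "row_plus (M ** kick c) \<noteq> 0" unfolding p using d C0 assms(1) by simp
  show "row_schur (M ** kick c) = disk_aut (schur_param c) (row_schur M)"
    unfolding row_schur_def[of "M ** kick c"] p n using C0 assms(1) by (simp add: disk_aut_def a_def)
qed

text \<open>
  The product is peeled off at the side of the first lattice point, because rows are acted on from
  the right and the automorphism of the first point is the outermost one.
\<close>

lemma pre_jump_Suc_right:
  "pre_jump ell c z (Suc k)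
    = pre_jump ell (\<lambda>j. c (Suc j)) z k ** rotation (z * of_real ell) ** kick (c 0)"
  by (induction k) (simp_all add: matrix_mul_assoc)

lemma row_schur_pre_jump:
  assumes z: "Im z > 0" and ell: "ell > 0" and M: "row_plus M \<noteq> 0" "norm (row_schur M) \<le> 1"
  shows "row_plus (M ** pre_jump ell c z k) \<noteq> 0"
    and "row_schur (M ** pre_jump ell c z k)
      = schur_compose k (\<lambda>j. schur_param (c j)) (\<lambda>_. row_schur M) (exp (2 * \<i> * of_real ell * z))"
proof -
  let ?\<zeta> = "exp (2 * \<i> * of_real ell * z)"
  have "row_plus (M ** pre_jump ell c z k) \<noteq> 0 \<and> row_schur (M ** pre_jump ell c z k)
      = schur_compose k (\<lambda>j. schur_param (c j)) (\<lambda>_. row_schur M) ?\<zeta>"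
  proof (induction k arbitrary: c)
    case (Suc k)
    let ?c = "\<lambda>j. c (Suc j)"
    let ?N = "M ** pre_jump ell ?c z k"
    let ?u = "schur_compose k (\<lambda>j. schur_param (?c j)) (\<lambda>_. row_schur M) ?\<zeta>"
    have N: "row_plus ?N \<noteq> 0" "row_schur ?N = ?u" using Suc[of ?c] by auto
    have z1: "norm ?\<zeta> < 1" using z ell by simp
    have "norm (?\<zeta> * ?u) \<le> norm ?\<zeta>"
      by (rule schur_class_times[OF schur_compose_schur_class])
         (use norm_schur_param_less schur_class_const[OF M(2)] z1 in auto)
    hence "norm (?\<zeta> * ?u) \<le> 1" using z1 by linarith
    moreover have R: "row_plus (?N ** rotation (z * of_real ell)) \<noteq> 0"
      "row_schur (?N ** rotation (z * of_real ell)) = ?\<zeta> * ?u"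
      using row_schur_rotation[OF N(1), of "z * of_real ell"] N(2) by (auto simp: mult_ac)
    ultimately have "norm (row_schur (?N ** rotation (z * of_real ell))) \<le> 1" by (simp only:)
    from row_schur_kick[OF R(1) this, of "c 0"] R(2) show ?case
      unfolding pre_jump_Suc_right by (simp add: matrix_mul_assoc)
  qed (simp add: M)
  thus "row_plus (M ** pre_jump ell c z k) \<noteq> 0"
    and "row_schur (M ** pre_jump ell c z k)
      = schur_compose k (\<lambda>j. schur_param (c j)) (\<lambda>_. row_schur M) ?\<zeta>"
    by auto
qed

lemma row_ratio:
  assumes "row_plus M \<noteq> 0"
  shows "M $ 2 $ 2 / M $ 2 $ 1 = \<i> * ((1 + row_schur M) / (1 - row_schur M))"
proof -
  let ?a = "row_minus M" and ?b = "row_plus M"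
  have "1 + row_schur M = (?b + ?a) / ?b" "1 - row_schur M = (?b - ?a) / ?b"
    using assms by (simp_all add: row_schur_def field_simps)
  hence "(1 + row_schur M) / (1 - row_schur M) = (?b + ?a) / (?b - ?a)" using assms by simp
  also have "\<dots> = M $ 2 $ 2 / (\<i> * M $ 2 $ 1)" by (simp add: row_minus_def row_plus_def)
  finally show ?thesis by simp
qed

text \<open>
  At \<open>x\<close> the transformed Weyl quotient is a composition of as many automorphisms as there are
  complete cells up to \<open>x\<close>, with a constant of modulus at most 1 as innermost function. By the
  contraction estimate it tends to the limit as \<open>x\<close> grows.
\<close>

lemma schur_function_point_masses:
  assumes ell: "ell > 0" and z: "Im z > 0"
  shows "schur_function (point_mass_sum ell c) z
    = schur_limit (\<lambda>k. schur_param (c k)) (exp (2 * \<i> * of_real ell * z))"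
proof -
  let ?q = "point_mass_sum ell c"
  let ?\<zeta> = "exp (2 * \<i> * of_real ell * z)"
  let ?a = "\<lambda>k. schur_param (c k)"
  let ?N = "discrete_solution ell c z"
  have z1: "norm ?\<zeta> < 1" using z ell by simp
  have a1: "norm (?a k) < 1" for k by (rule norm_schur_param_less)
  define F where "F = schur_limit ?a ?\<zeta>"
  have F1: "norm F < 1" unfolding F_def by (rule schur_limit_norm_less[of ?a, OF a1 z1])
  have near: "row_plus (?N x) \<noteq> 0 \<and> norm (row_schur (?N x) - F) \<le> 2 * norm ?\<zeta> ^ nat \<lfloor>x / ell\<rfloor>"
    if x: "x \<ge> 0" for x
  proof -
    define k where "k = nat \<lfloor>x / ell\<rfloor>"
    define R where "R = rotation (z * of_real (x - ell * real k))"
    have cell: "x \<in> {ell * real k..<ell * real (Suc k)}"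
      using x unfolding cell_iff[OF ell] by (simp add: k_def)
    have N: "?N x = R ** kick (c k) ** pre_jump ell c z k"
      using discrete_solution_cell[OF ell cell] by (simp add: R_def matrix_mul_assoc)
    have i: "row_plus (mat 1) = 1" "row_schur (mat 1) = 1"
      by (simp_all add: row_plus_def row_minus_def row_schur_def mat_def)
    have "row_plus (mat 1) \<noteq> 0" using i(1) by simp
    from row_schur_rotation[OF this, of "z * of_real (x - ell * real k)"]
    have R: "row_plus R \<noteq> 0" "row_schur R = exp (2 * \<i> * (z * of_real (x - ell * real k)))"
      by (simp_all only: R_def[symmetric] matrix_mul_lid i mult_1_right simp_thms)
    have "Im z * (x - ell * real k) \<ge> 0" using z cell by simp
    hence R1: "norm (row_schur R) \<le> 1" by (simp add: R(2) algebra_simps)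
    have K: "row_plus (R ** kick (c k)) \<noteq> 0"
      "row_schur (R ** kick (c k)) = disk_aut (?a k) (row_schur R)"
      using row_schur_kick[OF R(1) R1] by blast+
    have K1: "norm (row_schur (R ** kick (c k))) \<le> 1"
      unfolding K(2) using R1 by (rule norm_disk_aut_le[OF a1])
    have "row_schur (?N x) = schur_compose k ?a (\<lambda>_. row_schur (R ** kick (c k))) ?\<zeta>"
      unfolding N by (rule row_schur_pre_jump(2)[OF z ell K(1) K1])
    moreover have "F = schur_compose k ?a (schur_limit (\<lambda>j. ?a (k + j))) ?\<zeta>"
      unfolding F_def by (rule schur_limit_unfold[of ?a, OF a1 z1])
    ultimately have "norm (row_schur (?N x) - F) \<le> 2 * norm ?\<zeta> ^ k"
      using schur_compose_contraction[of ?a, OF a1 schur_class_const[OF K1] _ z1]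
        schur_limit_schur_class[of "\<lambda>j. ?a (k + j)", OF a1] by simp
    moreover have "row_plus (?N x) \<noteq> 0"
      unfolding N by (rule row_schur_pre_jump(1)[OF z ell K(1) K1])
    ultimately show ?thesis by (simp add: k_def)
  qed
  have "filterlim (\<lambda>x. 1 / ell * x) at_top at_top"
    by (rule filterlim_tendsto_pos_mult_at_top[OF tendsto_const _ filterlim_ident]) (use ell in simp)
  hence "filterlim (\<lambda>x. x / ell) at_top at_top" by simp
  hence "filterlim (\<lambda>x. nat \<lfloor>x / ell\<rfloor>) sequentially at_top"
    by (intro filterlim_compose[OF filterlim_nat_sequentially] filterlim_compose[OF filterlim_floor_sequentially])
  moreover have "(\<lambda>n. 2 * norm ?\<zeta> ^ n) \<longlonglongrightarrow> 0"
    using z1 by (intro tendsto_mult_right_zero LIMSEQ_power_zero) auto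
  ultimately have "((\<lambda>x. 2 * norm ?\<zeta> ^ nat \<lfloor>x / ell\<rfloor>) \<longlongrightarrow> 0) at_top"
    by (rule filterlim_compose[rotated])
  moreover have "\<forall>\<^sub>F x in at_top. norm (row_schur (?N x) - F) \<le> 2 * norm ?\<zeta> ^ nat \<lfloor>x / ell\<rfloor>"
    using eventually_ge_at_top[of 0] by eventually_elim (use near in blast)
  ultimately have "((\<lambda>x. row_schur (?N x) - F) \<longlongrightarrow> 0) at_top"
    by (rule Lim_null_comparison[rotated])
  hence "((\<lambda>x. row_schur (?N x)) \<longlongrightarrow> F) at_top" by (rule LIM_zero_cancel)
  moreover have F_ne: "F \<noteq> 1" using F1 by auto
  ultimately have "((\<lambda>x. \<i> * ((1 + row_schur (?N x)) / (1 - row_schur (?N x)))) \<longlongrightarrow> \<i> * ((1 + F) / (1 - F))) at_top"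
    by (intro tendsto_intros) auto
  moreover have "\<forall>\<^sub>F x in at_top. \<i> * ((1 + row_schur (?N x)) / (1 - row_schur (?N x))) = ?N x $ 2 $ 2 / ?N x $ 2 $ 1"
    using eventually_ge_at_top[of 0]
  proof eventually_elim
    case (elim x)
    show ?case by (rule row_ratio[symmetric]) (use near[OF elim] in blast)
  qed
  ultimately have "((\<lambda>x. ?N x $ 2 $ 2 / ?N x $ 2 $ 1) \<longlongrightarrow> \<i> * ((1 + F) / (1 - F))) at_top"
    by (rule Lim_transform_eventually)
  hence m: "weyl_function ?q z = \<i> * ((1 + F) / (1 - F))"
    unfolding weyl_function_def dirac_solution_point_masses[OF ell]
    by (intro tendsto_Lim) auto
  have d: "1 - F \<noteq> 0" using F_ne by simp
  have "weyl_function ?q z + \<i> = 2 * \<i> / (1 - F)" "weyl_function ?q z - \<i> = 2 * \<i> * F / (1 - F)"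
    unfolding m using d by (simp_all add: field_simps)
  moreover from this have "weyl_function ?q z \<noteq> - \<i>" using d by (auto simp: add_eq_0_iff2)
  ultimately show ?thesis using d by (simp add: schur_function_eq F_def)
qed

section \<open>Discrete potentials and periodic Schur functions\<close>

lemma recurrence_coeff_point_masses:
  assumes ell: "ell > 0"
  shows "recurrence_coeff ell (schur_function (point_mass_sum ell c)) k = schur_param (c k)"
proof -
  note ch = schur_chain_limit[of "\<lambda>k. schur_param (c k)", OF norm_schur_param_less]
  have "recurrence_coeff ell (schur_function (point_mass_sum ell c)) k
     = schur_limit (\<lambda>j. schur_param (c (k + j))) 0"
    by (rule schur_iterate_chain[where Fs = "\<lambda>k. schur_limit (\<lambda>j. schur_param (c (k + j)))",
          OF ell ch(1,3,4)])
       (simp_all add: schur_function_point_masses[OF ell])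
  thus ?thesis by (simp only: ch(2))
qed

text \<open>
  Being determined by its parameters, the function is the limit for its own recurrence coefficients,
  and \<open>varkappa\<close> recovers weights with these parameters.
\<close>

lemma schur_star_periodic_reconstruct:
  assumes ell: "ell > 0" and f: "f \<in> schur_star_periodic ell"
  shows "\<forall>z\<in>\<complex>\<^sub>+. schur_function (point_mass_sum ell (\<lambda>k. varkappa (recurrence_coeff ell f k))) z = f z"
proof
  fix z assume z: "z \<in> \<complex>\<^sub>+"
  obtain F where F: "F \<in> schur_star_disk"
    and fF: "\<And>z. Im z > 0 \<Longrightarrow> f z = F (exp (2 * \<i> * of_real ell * z))"
    using f by (auto simp: schur_star_periodic_def)
  let ?Fs = "\<lambda>k. (schur_step ^^ k) F"
  note ch = schur_star_chain[OF F]
  have rc: "recurrence_coeff ell f k = ?Fs k 0" for k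
    by (rule schur_iterate_chain[where Fs = ?Fs, OF ell ch]) (simp_all add: fF)
  have z1: "norm (exp (2 * \<i> * of_real ell * z)) < 1" using z ell by simp
  have "schur_function (point_mass_sum ell (\<lambda>k. varkappa (recurrence_coeff ell f k))) z
      = schur_limit (\<lambda>k. ?Fs k 0) (exp (2 * \<i> * of_real ell * z))"
    using schur_function_point_masses[OF ell] z schur_param_varkappa[OF ch(2)] by (simp add: rc)
  also have "\<dots> = ?Fs 0 (exp (2 * \<i> * of_real ell * z))"
    by (rule schur_chain_eq_limit[where Fs = ?Fs, OF ch z1, symmetric])
  also have "\<dots> = f z" using fF z by simp
  finally show "schur_function (point_mass_sum ell (\<lambda>k. varkappa (recurrence_coeff ell f k))) z = f z" .
qed

lemma recurrence_coeff_cong: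
  assumes "\<And>z. Im z > 0 \<Longrightarrow> f z = g z"
  shows "recurrence_coeff ell f k = recurrence_coeff ell g k"
proof -
  have val: "value_at_i_infinity u = value_at_i_infinity v"
    if "\<And>z. Im z > 0 \<Longrightarrow> u z = v z" for u v
  proof -
    have "\<forall>\<^sub>F y in at_top. u (\<i> * of_real y) = v (\<i> * of_real y)"
      using eventually_gt_at_top[of 0] by eventually_elim (simp add: that)
    hence "((\<lambda>y::real. u (\<i> * of_real y)) \<longlongrightarrow> l) at_top \<longleftrightarrow> ((\<lambda>y::real. v (\<i> * of_real y)) \<longlongrightarrow> l) at_top" for l
      by (rule tendsto_cong)
    thus ?thesis by (simp only: value_at_i_infinity_def t2_space_class.Lim_def)
  qed
  have "Im z > 0 \<Longrightarrow> schur_iterate ell f k z = schur_iterate ell g k z" for z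
  proof (induction k arbitrary: z)
    case (Suc k)
    show ?case using Suc.IH[OF Suc.prems] val[OF Suc.IH] by (simp add: Let_def)
  qed (simp add: assms)
  from val[OF this] show ?thesis by (simp add: recurrence_coeff_def)
qed

theorem theorem1p4:
  fixes ell :: real
  assumes "ell > 0"
  shows "(\<forall>q\<in>discrete_measures ell. schur_function q \<in> schur_star_periodic ell) \<and>
    (\<forall>q\<in>discrete_measures ell. \<forall>z\<in>\<complex>\<^sub>+.
       schur_function q (z + of_real (pi / ell)) = schur_function q z) \<and>
    (\<forall>f\<in>schur_star_periodic ell. \<exists>!q. q \<in> discrete_measures ell \<and>
       (\<forall>z\<in>\<complex>\<^sub>+. schur_function q z = f z)) \<and>
    (\<forall>q\<in>discrete_measures ell. \<forall>k.
       q {ell * real k} = varkappa (recurrence_coeff ell (schur_function q) k)) \<and>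
    (\<forall>f\<in>schur_star_periodic ell. \<forall>q\<in>discrete_measures ell.
       (\<forall>k. q {ell * real k} = varkappa (recurrence_coeff ell f k)) \<longrightarrow>
       (\<forall>z\<in>\<complex>\<^sub>+. schur_function q z = f z))"
proof (intro conjI ballI allI impI)
  note sf = schur_function_point_masses[OF assms]
  have masses: "\<exists>c. q = point_mass_sum ell c \<and> (\<forall>k. c k = q {ell * real k})"
    if "q \<in> discrete_measures ell" for q
    using that point_mass_sum_singleton[OF assms] by (auto simp: discrete_measures_def)
  have coeff: "q {ell * real k} = varkappa (recurrence_coeff ell (schur_function q) k)"
    if "q \<in> discrete_measures ell" for q k
    using masses[OF that] recurrence_coeff_point_masses[OF assms] varkappa_schur_param by metis
  thus "q {ell * real k} = varkappa (recurrence_coeff ell (schur_function q) k)"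
    if "q \<in> discrete_measures ell" for q k using that .
  {
    fix q assume q: "q \<in> discrete_measures ell"
    then obtain c where c: "q = point_mass_sum ell c" using masses by blast
    let ?F = "schur_limit (\<lambda>k. schur_param (c k))"
    have F: "?F \<in> schur_star_disk" by (rule schur_limit_schur_star) (rule norm_schur_param_less)
    have "norm (exp (2 * \<i> * of_real ell * z)) < 1" if "Im z > 0" for z using that assms by simp
    hence "norm (schur_function q z) < 1" if "Im z > 0" for z
      using that unfolding c sf[OF that]
      by (intro schur_limit_norm_less norm_schur_param_less) auto
    thus "schur_function q \<in> schur_star_periodic ell"
      unfolding schur_star_periodic_def using F sf by (auto simp: c)
    fix z assume z: "z \<in> \<complex>\<^sub>+"
    have "2 * \<i> * of_real ell * (z + of_real (pi / ell)) = 2 * \<i> * of_real ell * z + 2 * of_real pi * \<i>"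
      using assms by (simp add: algebra_simps)
    hence "exp (2 * \<i> * of_real ell * (z + of_real (pi / ell))) = exp (2 * \<i> * of_real ell * z)"
      by (simp add: exp_add exp_two_pi_i)
    moreover have "Im (z + of_real (pi / ell)) > 0" "Im z > 0" using z by simp_all
    ultimately show "schur_function q (z + of_real (pi / ell)) = schur_function q z"
      unfolding c by (simp only: sf)
  }
  have eq: "q = point_mass_sum ell (\<lambda>k. varkappa (recurrence_coeff ell f k))"
    if "q \<in> discrete_measures ell" "\<forall>k. q {ell * real k} = varkappa (recurrence_coeff ell f k)" for q f
    using masses[OF that(1)] that(2) by (metis (no_types, lifting) ext)
  fix f assume f: "f \<in> schur_star_periodic ell"
  note rec = schur_star_periodic_reconstruct[OF assms f]
  show "\<exists>!q. q \<in> discrete_measures ell \<and> (\<forall>z\<in>\<complex>\<^sub>+. schur_function q z = f z)"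
  proof (rule ex1I)
    show "point_mass_sum ell (\<lambda>k. varkappa (recurrence_coeff ell f k)) \<in> discrete_measures ell \<and>
        (\<forall>z\<in>\<complex>\<^sub>+. schur_function (point_mass_sum ell (\<lambda>k. varkappa (recurrence_coeff ell f k))) z = f z)"
      using rec discrete_measures_eq_range[OF assms] by blast
    fix q assume q: "q \<in> discrete_measures ell \<and> (\<forall>z\<in>\<complex>\<^sub>+. schur_function q z = f z)"
    hence "recurrence_coeff ell (schur_function q) k = recurrence_coeff ell f k" for k
      by (intro recurrence_coeff_cong) auto
    hence "\<forall>k. q {ell * real k} = varkappa (recurrence_coeff ell f k)"
      using coeff q by metis
    thus "q = point_mass_sum ell (\<lambda>k. varkappa (recurrence_coeff ell f k))"
      using eq q by blast
  qed
  show "schur_function q z = f z"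
    if "q \<in> discrete_measures ell" "\<forall>k. q {ell * real k} = varkappa (recurrence_coeff ell f k)" "z \<in> \<complex>\<^sub>+"
    for q z
    using eq[OF that(1,2)] rec that(3) by blast
qed

end
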